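(* Suppose that a $d$-regular graph has girth $g$ and diameter $D$, and let $AC$ be its algebraic connectivity. Then $$AC\le d-2(d-1)^{1/2}\cos\theta ,$$ where $\theta$ can be either of two of the following values: the one determined by the parity of $D$ and the one determined by the parity of $g$. (1) If $D$ is even with $D=2K$, then $\theta$ is the smallest positive root of $$\tan(\theta K)=-\frac{d}{d-2}\tan\theta .$$ (2) If $D$ is odd with $D=2K-1$, then $\theta$ is the smallest positive root of $$\tan(\theta K)=-\frac{\left(2\sqrt{d-1}\cos\theta+d\right)\sin\theta}{\sqrt{d-1}\left(d-2\cos^2\theta\right)+(d-2)\cos\theta}.$$ (3) If $g$ is even with $g=2K$, then $\theta=\pi/K$. (4) If $g$ is odd with $g=2K+1$, then $\theta$ is the smallest positive root of $$\tan(\theta K)=-\frac{\sin\theta}{(d-1)^{-1/2}+\cos\theta}.$$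
   Context: Graphs are finite and simple, and a graph with a (finite) diameter is connected. The algebraic connectivity $AC$ of a graph is the second smallest eigenvalue (counted with multiplicity) of its Laplacian matrix (degree matrix minus adjacency matrix). The girth is the length of a shortest cycle; the diameter is the largest distance between two vertices. In each case $K$ is the positive integer determined by the stated relation. *)

theory Defs
  imports "HOL-Analysis.Analysis" "HOL-Computational_Algebra.Polynomial" "HOL-Library.Multiset"
begin

text \<open>A finite graph is given by its adjacency relation on a finite vertex type.\<close>

definition simple_graph :: "('v::finite \<Rightarrow> 'v \<Rightarrow> bool) \<Rightarrow> bool" where
  "simple_graph E \<longleftrightarrow> symp E \<and> irreflp E"

definition vertex_degree :: "('v::finite \<Rightarrow> 'v \<Rightarrow> bool) \<Rightarrow> 'v \<Rightarrow> nat" where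
  "vertex_degree E v = card {w. E v w}"

definition regular_graph :: "('v::finite \<Rightarrow> 'v \<Rightarrow> bool) \<Rightarrow> nat \<Rightarrow> bool" where
  "regular_graph E d \<longleftrightarrow> (\<forall>v. vertex_degree E v = d)"

definition graph_connected :: "('v::finite \<Rightarrow> 'v \<Rightarrow> bool) \<Rightarrow> bool" where
  "graph_connected E \<longleftrightarrow> (\<forall>u v. E\<^sup>*\<^sup>* u v)"

text \<open>\<open>(E ^^ n) u v\<close> says that there is a walk with \<open>n\<close> edges from \<open>u\<close> to \<open>v\<close>, so the
  value below is meaningful only when \<open>v\<close> is reachable from \<open>u\<close>.\<close>

definition graph_dist :: "('v::finite \<Rightarrow> 'v \<Rightarrow> bool) \<Rightarrow> 'v \<Rightarrow> 'v \<Rightarrow> nat" where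
  "graph_dist E u v = (LEAST n. (E ^^ n) u v)"

definition has_diameter :: "('v::finite \<Rightarrow> 'v \<Rightarrow> bool) \<Rightarrow> nat \<Rightarrow> bool" where
  "has_diameter E D \<longleftrightarrow> graph_connected E \<and> D = Max (range (\<lambda>(u, v). graph_dist E u v))"

text \<open>A cycle is the list of its distinct vertices in cyclic order; the start vertex is not
  repeated at the end, so the length of the list is the number of edges.\<close>

definition is_cycle :: "('v::finite \<Rightarrow> 'v \<Rightarrow> bool) \<Rightarrow> 'v list \<Rightarrow> bool" where
  "is_cycle E c \<longleftrightarrow> 3 \<le> length c \<and> distinct c \<and>
     (\<forall>i < length c. E (c ! i) (c ! (Suc i mod length c)))"

definition has_girth :: "('v::finite \<Rightarrow> 'v \<Rightarrow> bool) \<Rightarrow> nat \<Rightarrow> bool" where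
  "has_girth E g \<longleftrightarrow> (\<exists>c. is_cycle E c \<and> length c = g) \<and> (\<forall>c. is_cycle E c \<longrightarrow> g \<le> length c)"

definition adjacency_matrix :: "('v::finite \<Rightarrow> 'v \<Rightarrow> bool) \<Rightarrow> real ^ 'v ^ 'v" where
  "adjacency_matrix E = (\<chi> i j. if E i j then 1 else 0)"

definition degree_matrix :: "('v::finite \<Rightarrow> 'v \<Rightarrow> bool) \<Rightarrow> real ^ 'v ^ 'v" where
  "degree_matrix E = (\<chi> i j. if i = j then real (vertex_degree E i) else 0)"

definition laplacian :: "('v::finite \<Rightarrow> 'v \<Rightarrow> bool) \<Rightarrow> real ^ 'v ^ 'v" where
  "laplacian E = degree_matrix E - adjacency_matrix E"

definition charpoly :: "real ^ 'n ^ 'n \<Rightarrow> real poly" where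
  "charpoly A = det (\<chi> i j. (if i = j then [:0, 1:] else 0) - [:A $ i $ j:])"

text \<open>Only real roots of the characteristic polynomial are listed; these are all eigenvalues
  when the matrix is symmetric.\<close>

definition eigenvalue_list :: "real ^ 'n ^ 'n \<Rightarrow> real list" where
  "eigenvalue_list A = sorted_list_of_multiset (proots (charpoly A))"

text \<open>List indices start at 0. The graph should have at least two vertices.\<close>

definition algebraic_connectivity :: "('v::finite \<Rightarrow> 'v \<Rightarrow> bool) \<Rightarrow> real" where
  "algebraic_connectivity E = eigenvalue_list (laplacian E) ! 1"

text \<open>The equations to which this is applied involve tangents and quotients. With the
  conventions \<open>x / 0 = 0\<close> and hence \<open>tan x = 0\<close> at poles, an equation holds at points where both
  sides are infinite, as if values were taken in the projective line. This matters in three cases.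
  The equation \<open>tan \<theta> = - (d / (d - 2)) * tan \<theta>\<close> (diameter 2, \<open>d > 2\<close>) has the smallest positive
  root \<open>pi / 2\<close>. In \<open>tan (\<theta> * K) = - (d / (d - 2)) * tan \<theta>\<close> with \<open>d = 2\<close>, the coefficient is
  infinite and the smallest positive root is \<open>pi / (2 * K)\<close>. These are also the smallest positive
  roots of the cleared form \<open>(d - 2) * sin (\<theta> * K) * cos \<theta> + d * cos (\<theta> * K) * sin \<theta> = 0\<close>.
  For the triangle (diameter 1, \<open>d = 2\<close>), the right-hand side of the odd-diameter equation is \<open>0 / 0\<close>
  at its smallest positive root \<open>pi\<close>; its limit there is also 0.\<close>

definition smallest_positive_root :: "(real \<Rightarrow> bool) \<Rightarrow> real \<Rightarrow> bool" where
  "smallest_positive_root eqn \<theta> \<longleftrightarrow> 0 < \<theta> \<and> eqn \<theta> \<and> (\<forall>t. 0 < t \<and> eqn t \<longrightarrow> \<theta> \<le> t)"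

end

theory Submission
  imports Defs
begin

text \<open>Write \<open>q = d - 1\<close>, \<open>\<mu> = 2 * sqrt q * cos \<theta>\<close>, and \<open>A\<close> for the adjacency matrix, so that the Laplacian is
\<open>d - A\<close> and the claim is that the second largest eigenvalue of \<open>A\<close> is at least \<open>\<mu>\<close>. It suffices to
find a two-dimensional space of functions on which the quadratic form of \<open>A\<close> is at least \<open>\<mu>\<close> times
the square of the norm, because this space contains a nonzero function orthogonal to the constants.

In all four cases the space is spanned by two nonnegative functions \<open>f1\<close> and \<open>f2\<close> with disjoint
supports such that \<open>A (f1 - f2) \<ge> \<mu> * f1\<close> holds on the support of \<open>f1\<close>, and likewise with the two
exchanged. That this is enough is the lemma \<open>algebraic_connectivity_le_two_functions\<close>. The functions
are copied from the \<open>d\<close>-regular tree, where the eigenvalue recursion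
\<open>\<mu> * f r = f (r - 1) + q * f (r + 1)\<close> is solved by \<open>f r = sqrt q powr (- r) * k r\<close> with sinusoids \<open>k\<close>
of frequency \<open>\<theta>\<close>.

For the diameter, \<open>f1\<close> and \<open>f2\<close> are radial functions on the balls of radius \<open>K - 1\<close> around two vertices
at distance \<open>D\<close>. The balls need not be trees, but a decreasing profile only gains from additional
short connections (\<open>ball_function_Rayleigh\<close>). If \<open>D = 2 * K\<close>, no edge joins the balls, and the profile
vanishes at \<open>K\<close>; if \<open>D = 2 * K - 1\<close>, edges may join their boundaries, and the profile satisfies
\<open>f K = - f (K - 1)\<close>. The equation for \<open>\<theta>\<close> expresses compatibility with the recursion at the centre,
which has \<open>d\<close> children instead of \<open>q\<close>.

For the girth, \<open>f1\<close> and \<open>f2\<close> live on the branches behind two neighbours of one vertex, with the profile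
\<open>sin (r * \<theta>)\<close>, which vanishes at this vertex (\<open>branch_function_Rayleigh\<close>). The branches are trees up
to half the girth. If \<open>g = 2 * K\<close>, they are cut off at the next zero, \<open>K * \<theta> = pi\<close>; if \<open>g = 2 * K + 1\<close>,
each leaf may in addition have one neighbour in the other branch, which leads to
\<open>q * f (K + 1) = - f K\<close>.

In each case \<open>\<theta> < pi / K\<close>, or \<open>\<theta> = pi / K\<close> for even girth, makes the profile positive where
it is used. The only exception is diameter 1, where \<open>\<theta> = pi\<close> and the two indicator
functions of adjacent vertices give more, namely the bound \<open>d + 1\<close>.\<close>

section \<open>An upper bound for the second smallest Laplacian eigenvalue\<close>

lemma poly_det:
  fixes A :: "real poly ^ 'n ^ 'n"
  shows "poly (det A) x = det (\<chi> i j. poly (A $ i $ j) x)"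
  by (simp add: det_def poly_sum poly_prod of_int_poly)

lemma poly_charpoly: "poly (charpoly A) x = det (mat x - A)"
  unfolding charpoly_def poly_det
  by (rule arg_cong[where f = det]) (simp add: vec_eq_iff mat_def)

lemma charpoly_root_iff:
  fixes A :: "real ^ 'n ^ 'n"
  shows "poly (charpoly A) x = 0 \<longleftrightarrow> (\<exists>v. v \<noteq> 0 \<and> A *v v = x *\<^sub>R v)"
proof -
  have "mat x *v v = x *\<^sub>R v" for v :: "real ^ 'n"
    by (simp add: vec_eq_iff matrix_vector_mult_def mat_def if_distrib[where f = "\<lambda>t. t * _"] cong: if_cong)
  then have *: "(mat x - A) *v v = 0 \<longleftrightarrow> A *v v = x *\<^sub>R v" for v
    by (auto simp: matrix_vector_mult_diff_rdistrib)
  have "det (mat x - A) = 0 \<longleftrightarrow> (\<exists>v. v \<noteq> 0 \<and> (mat x - A) *v v = 0)"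
    using invertible_det_nz[of "mat x - A"]
      matrix_left_invertible_ker[of "mat x - A"] invertible_left_inverse[of "mat x - A"] by metis
  with * show ?thesis by (simp add: poly_charpoly)
qed

lemma second_smallest_le:
  fixes M :: "real multiset"
  assumes "{#x, y#} \<subseteq># M" "x \<le> c" "y \<le> c"
  shows "sorted_list_of_multiset M ! 1 \<le> c"
proof (rule ccontr)
  assume *: "\<not> ?thesis"
  let ?l = "sorted_list_of_multiset M"
  have "filter (\<lambda>t. t \<le> c) ?l = filter (\<lambda>t. t \<le> c) (take 1 ?l)"
  proof -
    have "t \<notin> {..c}" if "t \<in> set (drop 1 ?l)" for t
    proof -
      obtain i where i: "i < length (drop 1 ?l)" "t = drop 1 ?l ! i"
        using \<open>t \<in> set (drop 1 ?l)\<close> by (metis in_set_conv_nth)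
      then have "t = ?l ! Suc i" "Suc i < length ?l" by auto
      moreover have "?l ! 1 \<le> ?l ! Suc i"
        using \<open>Suc i < length ?l\<close> by (intro sorted_nth_mono) auto
      ultimately show ?thesis using * by auto
    qed
    then have "filter (\<lambda>t. t \<le> c) (drop 1 ?l) = []" by (auto simp: filter_empty_conv)
    then show ?thesis by (metis append.right_neutral append_take_drop_id filter_append)
  qed
  then have "length (filter (\<lambda>t. t \<le> c) ?l) \<le> 1"
    by (metis length_filter_le length_take min.cobounded2 order_trans)
  moreover have "length (filter (\<lambda>t. t \<le> c) ?l) = size (filter_mset (\<lambda>t. t \<le> c) M)"
    by (metis mset_filter mset_sorted_list_of_multiset size_mset)
  moreover have "size (filter_mset (\<lambda>t. t \<le> c) M) \<ge> size (filter_mset (\<lambda>t. t \<le> c) {#x, y#})"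
    using assms(1) by (intro size_mset_mono multiset_filter_mono)
  ultimately show False using assms by simp
qed

text \<open>A positive semidefinite matrix does not have the eigenvalue \<open>-1\<close>.\<close>

lemma charpoly_nonzero: "charpoly A \<noteq> 0" if "\<And>v. 0 \<le> v \<bullet> (A *v v)"
proof
  assume "charpoly A = 0"
  then obtain v where "v \<noteq> 0" "A *v v = (-1) *\<^sub>R v"
    using charpoly_root_iff[of A "-1"] by auto
  with that[of v] show False by (simp add: flip: inner_gt_zero_iff)
qed

text \<open>The Rayleigh quotient attains its minimum on the unit sphere of the hyperplane orthogonal to the
null vector \<open>e\<close>, and the minimiser \<open>y\<close> is an eigenvector: the residual \<open>w = L *v y - l *\<^sub>R y\<close> lies in that
hyperplane again, so \<open>y + t *\<^sub>R w\<close> is an admissible competitor for every \<open>t\<close>, and minimality gives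
\<open>0 \<le> 2 * t * (w \<bullet> w) + t\<^sup>2 * C\<close>, which for small negative \<open>t\<close> forces \<open>w = 0\<close>.\<close>

lemma Rayleigh_minimiser:
  fixes L :: "real ^ 'n ^ 'n" and e :: "real ^ 'n"
  assumes sym: "transpose L = L" and Le: "L *v e = 0"
    and z: "z \<bullet> e = 0" "z \<noteq> 0" "z \<bullet> (L *v z) \<le> c * (z \<bullet> z)"
  obtains y l where "y \<noteq> 0" "y \<bullet> e = 0" "L *v y = l *\<^sub>R y" "l \<le> c"
proof -
  define S where "S = {z. z \<bullet> e = 0} \<inter> sphere (0 :: real ^ 'n) 1"
  define Q where "Q v = v \<bullet> (L *v v)" for v
  have sL: "u \<bullet> (L *v v) = v \<bullet> (L *v u)" for u v
    by (metis dot_lmul_matrix inner_commute sym transpose_matrix_vector)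
  have "closed {z. z \<bullet> e = 0}"
    using closed_hyperplane[of e 0] by (simp add: inner_commute)
  then have "compact S" unfolding S_def by (intro closed_Int_compact) auto
  moreover have "(1 / norm z) *\<^sub>R z \<in> S" using z by (simp add: S_def)
  moreover have "continuous_on S Q"
    unfolding Q_def by (intro continuous_intros matrix_vector_mult_linear_continuous_on)
  ultimately obtain y where y: "y \<in> S" "\<And>v. v \<in> S \<Longrightarrow> Q y \<le> Q v"
    using continuous_attains_inf[of S Q] by blast
  define l where "l = Q y"
  have low: "l * (v \<bullet> v) \<le> Q v" if "v \<bullet> e = 0" for v
  proof (cases "v = 0")
    case False
    then have "(1 / norm v) *\<^sub>R v \<in> S" using that by (simp add: S_def)
    then have "l \<le> Q ((1 / norm v) *\<^sub>R v)" using y l_def by blast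
    also have "\<dots> = Q v / (v \<bullet> v)"
      by (simp add: Q_def matrix_vector_mult_scaleR dot_square_norm power2_eq_square)
    finally show ?thesis using False by (simp add: field_simps)
  qed (simp add: Q_def)
  have ye: "y \<bullet> e = 0" and yy: "y \<bullet> y = 1" and y0: "y \<noteq> 0"
    using y(1) by (auto simp: S_def dot_square_norm)
  define w where "w = L *v y - l *\<^sub>R y"
  have we: "w \<bullet> e = 0"
    using sL[of e y] ye Le by (simp add: w_def inner_diff_left inner_diff_right inner_commute)
  define C where "C = Q w - l * (w \<bullet> w)"
  have quad: "0 \<le> 2 * t * (w \<bullet> w) + t\<^sup>2 * C" for t
  proof -
    have "l * ((y + t *\<^sub>R w) \<bullet> (y + t *\<^sub>R w)) \<le> Q (y + t *\<^sub>R w)"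
      using low[of "y + t *\<^sub>R w"] ye we by (simp add: inner_add_left)
    moreover have "Q (y + t *\<^sub>R w) = l + 2 * t * (w \<bullet> (L *v y)) + t\<^sup>2 * Q w"
      using sL[of y w] by (simp add: Q_def l_def matrix_vector_right_distrib
          matrix_vector_mult_scaleR inner_add_left inner_add_right power2_eq_square algebra_simps)
    moreover have "(y + t *\<^sub>R w) \<bullet> (y + t *\<^sub>R w) = 1 + 2 * t * (w \<bullet> y) + t\<^sup>2 * (w \<bullet> w)"
      using yy by (simp add: inner_add_left inner_add_right inner_commute power2_eq_square algebra_simps)
    ultimately have "l * (1 + 2 * t * (w \<bullet> y) + t\<^sup>2 * (w \<bullet> w))
      \<le> l + 2 * t * (w \<bullet> (L *v y)) + t\<^sup>2 * Q w"
      by (simp only:)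
    moreover have "w \<bullet> (L *v y) = w \<bullet> w + l * (w \<bullet> y)"
      by (subst (3) w_def) (simp add: inner_diff_right)
    ultimately show ?thesis by (simp add: C_def algebra_simps)
  qed
  have "w \<bullet> w = 0"
  proof (rule ccontr)
    assume "w \<bullet> w \<noteq> 0"
    then have pos: "w \<bullet> w > 0" by (simp add: inner_gt_zero_iff)
    \<comment> \<open>so small that the linear term outweighs the quadratic one\<close>
    define t where "t = - (w \<bullet> w) / (\<bar>C\<bar> + 1)"
    have "t < 0" using pos by (simp add: t_def divide_neg_pos)
    have "- t * C \<le> - t * (\<bar>C\<bar> + 1)" using \<open>t < 0\<close> by (intro mult_left_mono) auto
    also have "\<dots> = w \<bullet> w" by (simp add: t_def)
    finally have "0 < 2 * (w \<bullet> w) + t * C" using pos by linarith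
    then have "t * (2 * (w \<bullet> w) + t * C) < 0" using \<open>t < 0\<close> mult_neg_pos by blast
    with quad[of t] show False by (simp add: power2_eq_square algebra_simps)
  qed
  then have "L *v y = l *\<^sub>R y" by (simp add: w_def)
  moreover have "l \<le> c"
  proof -
    have "l * (z \<bullet> z) \<le> c * (z \<bullet> z)" using low[OF z(1)] z(3) by (simp add: Q_def)
    moreover have "z \<bullet> z > 0" using z(2) by simp
    ultimately show ?thesis by (simp add: mult_le_cancel_right)
  qed
  ultimately show thesis using that y0 ye by blast
qed

lemma adjacency_mult:
  "(adjacency_matrix E *v x) $ i = (\<Sum>j | E i j. x $ j)"
  by (simp add: adjacency_matrix_def matrix_vector_mult_def if_distrib[where f = "\<lambda>t. t * _"] sum.If_cases cong: if_cong)

lemma laplacian_mult: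
  assumes "regular_graph E d"
  shows "laplacian E *v x = real d *\<^sub>R x - adjacency_matrix E *v x"
proof -
  have "degree_matrix E *v x = real d *\<^sub>R x" using assms
    by (simp add: vec_eq_iff degree_matrix_def matrix_vector_mult_def regular_graph_def if_distrib[where f = "\<lambda>t. t * _"] cong: if_cong)
  then show ?thesis by (simp add: laplacian_def matrix_vector_mult_diff_rdistrib)
qed

lemma adjacency_sym:
  assumes "simple_graph E" shows "transpose (adjacency_matrix E) = adjacency_matrix E"
  using assms by (auto simp: simple_graph_def adjacency_matrix_def transpose_def vec_eq_iff dest: sympD)

lemma laplacian_sym:
  assumes "simple_graph E" shows "transpose (laplacian E) = laplacian E"
  using assms by (auto simp: simple_graph_def laplacian_def degree_matrix_def adjacency_matrix_def transpose_def vec_eq_iff dest: sympD)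

lemma laplacian_quadratic_form:
  assumes "simple_graph E" "regular_graph E d"
  shows "x \<bullet> (laplacian E *v x) = (\<Sum>i\<in>UNIV. \<Sum>j | E i j. (x $ i - x $ j)\<^sup>2) / 2"
proof -
  have deg: "card {j. E i j} = d" for i
    using assms by (simp add: regular_graph_def vertex_degree_def)
  have E: "E i j \<longleftrightarrow> E j i" for i j using assms by (auto simp: simple_graph_def dest: sympD)
  have "(\<Sum>i\<in>UNIV. \<Sum>j | E i j. (x $ j)\<^sup>2) = (\<Sum>i\<in>UNIV. \<Sum>j\<in>UNIV. if E i j then (x $ j)\<^sup>2 else 0)"
    by (simp add: sum.If_cases)
  also have "\<dots> = (\<Sum>i\<in>UNIV. \<Sum>j | E i j. (x $ i)\<^sup>2)"
    by (subst sum.swap) (simp add: sum.If_cases E)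
  finally have sw: "(\<Sum>i\<in>UNIV. \<Sum>j | E i j. (x $ j)\<^sup>2) = real d * (\<Sum>i\<in>UNIV. (x $ i)\<^sup>2)"
    by (simp add: deg sum_distrib_left)
  have "(\<Sum>i\<in>UNIV. \<Sum>j | E i j. (x $ i - x $ j)\<^sup>2)
    = (\<Sum>i\<in>UNIV. \<Sum>j | E i j. (x $ i)\<^sup>2) + (\<Sum>i\<in>UNIV. \<Sum>j | E i j. (x $ j)\<^sup>2)
      - 2 * (\<Sum>i\<in>UNIV. \<Sum>j | E i j. x $ i * x $ j)"
    by (simp add: power2_diff sum.distrib sum_subtractf sum_distrib_left mult.assoc)
  also have "(\<Sum>i\<in>UNIV. \<Sum>j | E i j. x $ i * x $ j) = x \<bullet> (adjacency_matrix E *v x)"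
    by (simp add: inner_vec_def adjacency_mult sum_distrib_left)
  finally show ?thesis
    by (simp add: sw deg laplacian_mult[OF assms(2)] inner_diff_right flip: sum_distrib_left)
      (simp add: inner_vec_def power2_eq_square)
qed

lemma connected_constant:
  assumes "graph_connected E" "\<And>i j. E i j \<Longrightarrow> f i = f j"
  shows "f u = f v"
proof -
  have "E\<^sup>*\<^sup>* u v" using assms by (simp add: graph_connected_def)
  then show ?thesis by induction (use assms in auto)
qed

text \<open>The minimiser above has an eigenvalue \<open>l \<le> c\<close>, and the constants have the eigenvalue \<open>0\<close>. A null vector
of the Laplacian of a connected graph is constant, so \<open>l \<noteq> 0\<close>. Hence \<open>0\<close> and \<open>l\<close> are two different
roots of the characteristic polynomial, and both are at most \<open>c\<close>; multiplicities do not enter.\<close>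

lemma algebraic_connectivity_le_Rayleigh:
  fixes E :: "'v::finite \<Rightarrow> 'v \<Rightarrow> bool"
  assumes G: "simple_graph E" "regular_graph E d" "graph_connected E"
    and z: "(\<Sum>i\<in>UNIV. z $ i) = 0" "z \<noteq> 0" "z \<bullet> (laplacian E *v z) \<le> c * (z \<bullet> z)"
  shows "algebraic_connectivity E \<le> c"
proof -
  let ?L = "laplacian E"
  let ?e = "1 :: real ^ 'v"
  have psd: "0 \<le> v \<bullet> (?L *v v)" for v
    unfolding laplacian_quadratic_form[OF G(1,2)] by (simp add: sum_nonneg)
  have Le: "?L *v ?e = 0" using G(2)
    by (simp add: laplacian_mult vec_eq_iff adjacency_mult regular_graph_def vertex_degree_def)
  have ze: "z \<bullet> ?e = 0" using z by (simp add: inner_vec_def)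
  obtain y l where y: "y \<noteq> 0" "y \<bullet> ?e = 0" "?L *v y = l *\<^sub>R y" "l \<le> c"
    using Rayleigh_minimiser[OF laplacian_sym[OF G(1)] Le ze z(2,3)] by metis
  have l0: "0 \<le> l"
    using psd[of y] y by (simp add: zero_le_mult_iff)
      (metis inner_gt_zero_iff not_less)
  have "l \<noteq> 0"
  proof
    assume "l = 0"
    with y have "(\<Sum>i\<in>UNIV. \<Sum>j | E i j. (y $ i - y $ j)\<^sup>2) = 0"
      using laplacian_quadratic_form[OF G(1,2), of y] by simp
    then have "y $ i = y $ j" if "E i j" for i j
      using that by (simp add: sum_nonneg_eq_0_iff sum_nonneg)
    then have "y $ i = y $ j" for i j using connected_constant[OF G(3), of "\<lambda>i. y $ i"] by blast
    then obtain k where k: "\<And>i. y $ i = k" by metis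
    with y(2) have "k = 0" by (simp add: inner_vec_def)
    with k y(1) show False by (simp add: vec_eq_iff)
  qed
  let ?M = "proots (charpoly ?L)"
  have nz: "charpoly ?L \<noteq> 0" by (rule charpoly_nonzero) (rule psd)
  have "0 \<in># ?M" using nz charpoly_root_iff[of ?L 0] Le by (auto simp: vec_eq_iff intro!: exI[of _ ?e])
  moreover have "l \<in># ?M" using nz charpoly_root_iff[of ?L l] y by auto
  ultimately have "{#0, l#} \<subseteq># ?M" using \<open>l \<noteq> 0\<close>
    by (simp add: insert_subset_eq_iff in_diff_count)
  then show ?thesis
    unfolding algebraic_connectivity_def eigenvalue_list_def
    using second_smallest_le[of 0 l ?M c] l0 y(4) by simp
qed

text \<open>Let \<open>A\<close> be the adjacency matrix and \<open>m = f1 \<bullet> A f2 \<ge> 0\<close>. Pairing the two inequalities with \<open>f1\<close> and \<open>f2\<close>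
gives \<open>f \<bullet> A f \<ge> \<mu> * (f \<bullet> f) + m\<close> for both functions. So for every combination \<open>z = a * f1 + b * f2\<close>
the value \<open>z \<bullet> A z - \<mu> * (z \<bullet> z)\<close> is at least \<open>(a\<^sup>2 + b\<^sup>2 + 2 * a * b) * m \<ge> 0\<close>. One nonzero
combination is orthogonal to the constants, and its Rayleigh quotient bounds the algebraic
connectivity. The negative sign of the other function in the hypotheses is what allows edges
between the two supports.\<close>

lemma algebraic_connectivity_le_two_functions:
  fixes E :: "'v::finite \<Rightarrow> 'v \<Rightarrow> bool" and f1 f2 :: "'v \<Rightarrow> real"
  assumes G: "simple_graph E" "regular_graph E d" "graph_connected E"
    and nonneg: "\<And>x. 0 \<le> f1 x" "\<And>x. 0 \<le> f2 x"
    and disj: "\<And>x. f1 x = 0 \<or> f2 x = 0"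
    and nz: "f1 a1 \<noteq> 0" "f2 a2 \<noteq> 0"
    and ineq1: "\<And>x. f1 x \<noteq> 0 \<Longrightarrow> \<mu> * f1 x \<le> (\<Sum>y | E x y. f1 y - f2 y)"
    and ineq2: "\<And>x. f2 x \<noteq> 0 \<Longrightarrow> \<mu> * f2 x \<le> (\<Sum>y | E x y. f2 y - f1 y)"
  shows "algebraic_connectivity E \<le> real d - \<mu>"
proof -
  let ?A = "adjacency_matrix E"
  define F1 F2 where "F1 = (\<chi> x. f1 x)" and "F2 = (\<chi> x. f2 x)"
  have sA: "u \<bullet> (?A *v v) = v \<bullet> (?A *v u)" for u v
    by (metis dot_lmul_matrix inner_commute adjacency_sym[OF G(1)] transpose_matrix_vector)
  define m where "m = F1 \<bullet> (?A *v F2)"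
  have "0 \<le> m" unfolding m_def F1_def F2_def
    by (simp add: inner_vec_def adjacency_mult nonneg sum_nonneg)
  have key: "\<mu> * (U \<bullet> U) \<le> U \<bullet> (?A *v (U - V))"
    if "\<And>x. 0 \<le> U $ x" "\<And>x. U $ x \<noteq> 0 \<Longrightarrow> \<mu> * U $ x \<le> (\<Sum>y | E x y. U $ y - V $ y)" for U V
    unfolding inner_vec_def sum_distrib_left
  proof (rule sum_mono)
    fix x
    have "U $ x * (\<mu> * U $ x) \<le> U $ x * (\<Sum>y | E x y. U $ y - V $ y)"
      using that[of x] by (cases "U $ x = 0") (auto intro: mult_left_mono)
    then show "\<mu> * (U $ x \<bullet> U $ x) \<le> U $ x \<bullet> (?A *v (U - V)) $ x"
      by (simp add: adjacency_mult sum_subtractf algebra_simps)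
  qed
  have k1: "\<mu> * (F1 \<bullet> F1) + m \<le> F1 \<bullet> (?A *v F1)"
    using key[of F1 F2] nonneg ineq1
    by (simp add: F1_def F2_def m_def matrix_vector_mult_diff_distrib inner_diff_right)
  have k2: "\<mu> * (F2 \<bullet> F2) + m \<le> F2 \<bullet> (?A *v F2)"
    using key[of F2 F1] nonneg ineq2 sA[of F1 F2]
    by (simp add: F1_def F2_def m_def matrix_vector_mult_diff_distrib inner_diff_right)
  have orth: "F1 \<bullet> F2 = 0" using disj by (auto simp: F1_def F2_def inner_vec_def intro!: sum.neutral)
  \<comment> \<open>the weights that make the entries of the combination sum to 0\<close>
  define a b where "a = (\<Sum>x\<in>UNIV. f2 x)" and "b = - (\<Sum>x\<in>UNIV. f1 x)"
  have "a > 0" unfolding a_def using nonneg nz by (intro sum_pos2[of _ a2]) (auto simp: less_le)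
  define z where "z = a *\<^sub>R F1 + b *\<^sub>R F2"
  have s0: "(\<Sum>i\<in>UNIV. z $ i) = 0"
    by (simp add: z_def F1_def F2_def sum.distrib flip: sum_distrib_left) (simp add: a_def b_def)
  have "z $ a1 \<noteq> 0" using disj[of a1] nz \<open>a > 0\<close> by (simp add: z_def F1_def F2_def)
  then have "z \<noteq> 0" by auto
  have zz: "z \<bullet> z = a\<^sup>2 * (F1 \<bullet> F1) + b\<^sup>2 * (F2 \<bullet> F2)"
    using orth by (simp add: z_def inner_add_left inner_add_right inner_commute power2_eq_square)
  have "z \<bullet> (?A *v z) = a\<^sup>2 * (F1 \<bullet> (?A *v F1)) + b\<^sup>2 * (F2 \<bullet> (?A *v F2)) + 2 * a * b * m"
    using sA[of F2 F1] by (simp add: z_def m_def inner_add_left inner_add_right matrix_vector_right_distrib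
      matrix_vector_mult_scaleR power2_eq_square algebra_simps)
  also have "\<dots> \<ge> a\<^sup>2 * (\<mu> * (F1 \<bullet> F1) + m) + b\<^sup>2 * (\<mu> * (F2 \<bullet> F2) + m) + 2 * a * b * m"
    by (intro add_right_mono add_mono mult_left_mono k1 k2) auto
  also have "a\<^sup>2 * (\<mu> * (F1 \<bullet> F1) + m) + b\<^sup>2 * (\<mu> * (F2 \<bullet> F2) + m) + 2 * a * b * m
    = \<mu> * (z \<bullet> z) + (a + b)\<^sup>2 * m"
    by (simp add: zz power2_eq_square algebra_simps)
  finally have "\<mu> * (z \<bullet> z) \<le> z \<bullet> (?A *v z)"
    using \<open>0 \<le> m\<close> by (smt (verit) mult_nonneg_nonneg zero_le_power2)
  then have "z \<bullet> (laplacian E *v z) \<le> (real d - \<mu>) * (z \<bullet> z)"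
    by (simp add: laplacian_mult[OF G(2)] inner_diff_right algebra_simps)
  then show ?thesis using algebraic_connectivity_le_Rayleigh[OF G s0 \<open>z \<noteq> 0\<close>] by blast
qed

section \<open>Short cycles from pairs of geodesics\<close>

text \<open>Take a repetition \<open>w i = w (i + k)\<close> with the smallest gap \<open>k > 0\<close>. The vertices in between are distinct,
and the gap is not \<open>1\<close> because there are no loops and not \<open>2\<close> because the walk never turns back.\<close>

lemma cycle_of_nonbacktracking_walk:
  fixes E :: "'v::finite \<Rightarrow> 'v \<Rightarrow> bool" and w :: "nat \<Rightarrow> 'v"
  assumes "simple_graph E"
    and step: "\<And>i. i < n \<Longrightarrow> E (w i) (w (Suc i))"
    and nonback: "\<And>i. i + 2 \<le> n \<Longrightarrow> w i \<noteq> w (i + 2)"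
    and rep: "i0 < j0" "j0 \<le> n" "w i0 = w j0"
  obtains c where "is_cycle E c" "length c \<le> n"
proof -
  define P where "P k \<longleftrightarrow> (\<exists>i. 0 < k \<and> i + k \<le> n \<and> w i = w (i + k))" for k
  define k where "k = (LEAST k. P k)"
  have "P (j0 - i0)" unfolding P_def using rep by (intro exI[of _ i0]) auto
  then have "P k" unfolding k_def by (rule LeastI)
  then obtain i where i: "0 < k" "i + k \<le> n" "w i = w (i + k)" unfolding P_def by blast
  have irr: "\<not> E x x" for x using assms(1) by (auto simp: simple_graph_def irreflp_def)
  have "k \<noteq> 1" using i step[of i] irr[of "w i"] by auto
  moreover have "k \<noteq> 2" using i nonback[of i] by auto
  ultimately have "3 \<le> k" using i(1) by linarith
  let ?c = "map w [i..<i + k]"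
  have "w a \<noteq> w b" if "a \<in> {i..<i + k}" "b \<in> {i..<i + k}" "a < b" for a b
  proof
    assume "w a = w b"
    then have "P (b - a)" unfolding P_def using that i by (intro exI[of _ a]) auto
    then have "k \<le> b - a" unfolding k_def by (rule Least_le)
    then show False using that by auto
  qed
  then have "inj_on w {i..<i + k}" by (intro linorder_inj_onI) auto
  then have "distinct ?c" by (simp add: distinct_map)
  moreover have "E (?c ! m) (?c ! (Suc m mod length ?c))" if "m < length ?c" for m
  proof (cases "Suc m = k")
    case True
    then have "Suc (i + m) = i + k" "m < k" by auto
    with i step[of "i + m"] show ?thesis by (simp del: upt_Suc)
  next
    case False
    with that i step[of "i + m"] show ?thesis by (simp del: upt_Suc)
  qed
  ultimately have "is_cycle E ?c" unfolding is_cycle_def using \<open>3 \<le> k\<close> by auto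
  then show thesis using that[of ?c] i by simp
qed

locale finite_connected_graph =
  fixes E :: "'v::finite \<Rightarrow> 'v \<Rightarrow> bool"
  assumes simple: "simple_graph E" and conn: "graph_connected E"
begin

abbreviation dst :: "'v \<Rightarrow> 'v \<Rightarrow> nat" where "dst \<equiv> graph_dist E"

lemma E_sym: "E x y \<longleftrightarrow> E y x"
  using simple by (auto simp: simple_graph_def dest: sympD)

lemma E_irrefl: "\<not> E x x"
  using simple by (auto simp: simple_graph_def irreflp_def)

lemma walk_dst: "(E ^^ dst u v) u v"
proof -
  have "\<exists>n. (E ^^ n) u v" using conn unfolding graph_connected_def rtranclp_power by blast
  then show ?thesis unfolding graph_dist_def by (rule LeastI_ex)
qed

lemma dst_le: "(E ^^ n) u v \<Longrightarrow> dst u v \<le> n"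
  unfolding graph_dist_def by (rule Least_le)

lemma dst_eq_0_iff [simp]: "dst u v = 0 \<longleftrightarrow> u = v"
  using walk_dst[of u v] dst_le[of 0 u v] by auto

lemma dst_self [simp]: "dst u u = 0"
  by simp

lemma dst_triangle: "dst u w \<le> dst u v + dst v w"
  by (rule dst_le) (use walk_dst[of u v] walk_dst[of v w] in \<open>auto simp: relpowp_add\<close>)

lemma dst_adj: "E x y \<Longrightarrow> dst x y = 1"
  using dst_le[of 1 x y] E_irrefl[of x] dst_eq_0_iff[of x y] by (cases "dst x y") auto

lemma dst_commute: "dst u v = dst v u"
proof -
  have rev: "(E ^^ n) u v \<Longrightarrow> (E ^^ n) v u" for n u v
  proof (induction n arbitrary: v)
    case (Suc n)
    then obtain w where "(E ^^ n) u w" "E w v" by auto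
    then show ?case using Suc.IH[of w] E_sym[of w v] relpowp_Suc_I2[of E v w n u] by simp
  qed auto
  have "dst u v \<le> dst v u" for u v by (rule dst_le[OF rev[OF walk_dst]])
  then show ?thesis by (intro order_antisym)
qed

lemma dst_step: "E x y \<Longrightarrow> dst u y \<le> Suc (dst u x)"
  using dst_triangle[of u y x] dst_adj[of x y] by simp

lemma predecessor:
  assumes "dst u x = Suc r"
  obtains y where "E x y" "dst u y = r"
proof -
  obtain y where y: "(E ^^ r) u y" "E y x" using walk_dst[of u x] assms by auto
  then have "dst u y = r" using dst_le[of r u y] dst_step[of y x u] assms by linarith
  with y that E_sym show thesis by blast
qed

definition geodesic :: "(nat \<Rightarrow> 'v) \<Rightarrow> nat \<Rightarrow> bool" where
  "geodesic p n \<longleftrightarrow> (\<forall>i<n. E (p i) (p (Suc i))) \<and> (\<forall>i\<le>n. dst (p 0) (p i) = i)"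

lemma geodesic_extend:
  assumes "geodesic p n" "E (p n) b" "dst (p 0) b = Suc n"
  shows "geodesic (p(Suc n := b)) (Suc n)"
  using assms by (auto simp: geodesic_def less_Suc_eq le_Suc_eq)

lemma geodesic_exists:
  assumes "dst u v = n"
  obtains p where "geodesic p n" "p 0 = u" "p n = v"
proof -
  have "\<exists>p. geodesic p n \<and> p 0 = u \<and> p n = v"
    using assms
  proof (induction n arbitrary: v)
    case 0
    then show ?case by (intro exI[of _ "\<lambda>_. u"]) (auto simp: geodesic_def)
  next
    case (Suc n)
    obtain y where "E v y" "dst u y = n" using predecessor[OF Suc(2)] .
    with Suc obtain p where "geodesic p n" "p 0 = u" "p n = y" by blast
    with \<open>E v y\<close> Suc(2) geodesic_extend[of p n v] show ?case
      by (intro exI[of _ "p(Suc n := v)"]) (auto simp: E_sym simp del: fun_upd_apply, auto)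
  qed
  with that show thesis by blast
qed

text \<open>The closed walk runs along \<open>p\<close>, crosses the edge and returns along \<open>q\<close>. A geodesic never turns back,
so the two hypotheses about the ends of the edge are all that has to be checked.\<close>

lemma cycle_of_two_geodesics:
  assumes p: "geodesic p m" and q: "geodesic q n" and start: "p 0 = q 0"
    and edge: "E (p m) (q n)"
    and p_turn: "m > 0 \<Longrightarrow> p (m - 1) \<noteq> q n" and q_turn: "n > 0 \<Longrightarrow> q (n - 1) \<noteq> p m"
  obtains c where "is_cycle E c" "length c \<le> m + n + 1"
proof -
  define w where "w i = (if i \<le> m then p i else q (m + n + 1 - i))" for i
  have "E (w i) (w (Suc i))" if "i < m + n + 1" for i
  proof -
    consider "i < m" | "i = m" | "i > m" by linarith
    then show ?thesis
    proof cases
      case 3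
      define k where "k = m + n - i"
      have "m + n + 1 - i = Suc k" "m + n + 1 - Suc i = k" "k < n" using 3 that by (auto simp: k_def)
      with 3 q show ?thesis by (auto simp: w_def geodesic_def E_sym)
    qed (use p edge in \<open>auto simp: w_def geodesic_def\<close>)
  qed
  moreover have "w i \<noteq> w (i + 2)" if "i + 2 \<le> m + n + 1" for i
  proof -
    consider "i + 2 \<le> m" | "i + 1 = m" | "i = m" | "i > m" by linarith
    then show ?thesis
    proof cases
      case 1
      then have "dst (p 0) (p i) = i" "dst (p 0) (p (i + 2)) = i + 2"
        using p unfolding geodesic_def by auto
      with 1 show ?thesis by (auto simp: w_def)
    next
      case 2
      then have "m + n + 1 - (i + 2) = n" "m - 1 = i" by auto
      with 2 p_turn show ?thesis by (auto simp: w_def)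
    next
      case 3
      then have "m + n + 1 - (i + 2) = n - 1" "n > 0" using that by auto
      with 3 q_turn show ?thesis by (auto simp: w_def)
    next
      case 4
      define k where "k = m + n + 1 - (i + 2)"
      have k: "m + n + 1 - i = k + 2" "k + 2 \<le> n" using 4 that by (auto simp: k_def)
      then have "dst (q 0) (q k) = k" "dst (q 0) (q (k + 2)) = k + 2"
        using q unfolding geodesic_def by auto
      then have "q (k + 2) \<noteq> q k" by auto
      with 4 k k_def show ?thesis by (auto simp: w_def)
    qed
  qed
  moreover have "w 0 = w (m + n + 1)" using start by (simp add: w_def)
  ultimately show thesis
    using cycle_of_nonbacktracking_walk[OF simple, of "m + n + 1" w 0 "m + n + 1"] that by auto
qed

text \<open>Below half the girth, every vertex other than \<open>a\<close> has only one neighbour closer to \<open>a\<close>, and by the next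
lemma no neighbour at its own distance. Together these facts make balls look like trees.\<close>

lemma girth_le_two_predecessors:
  assumes g: "has_girth E g"
    and "dst a b = Suc r" "E b y" "E b y'" "y \<noteq> y'" "dst a y = r" "dst a y' = r"
  shows "g \<le> 2 * Suc r"
proof -
  obtain p where p: "geodesic p r" "p 0 = a" "p r = y"
    using geodesic_exists[OF assms(6)] .
  obtain q where q: "geodesic q r" "q 0 = a" "q r = y'"
    using geodesic_exists[OF assms(7)] .
  have "E y b" using assms(3) E_sym by blast
  then have "geodesic (p(Suc r := b)) (Suc r)"
    using geodesic_extend[OF p(1), of b] p(2,3) assms(2) by simp
  moreover have "q (r - 1) \<noteq> b"
  proof -
    have "dst a (q (r - 1)) = r - 1" using q by (auto simp: geodesic_def)
    then show ?thesis using assms(2) by auto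
  qed
  ultimately obtain c where "is_cycle E c" "length c \<le> Suc r + r + 1"
    using cycle_of_two_geodesics[of "p(Suc r := b)" "Suc r" q r] p(2,3) q assms(4,5) by auto
  then show ?thesis using g by (force simp: has_girth_def)
qed

lemma girth_le_level_edge:
  assumes g: "has_girth E g" and "E x y" "dst a x = r" "dst a y = r"
  shows "g \<le> 2 * r + 1"
proof -
  obtain p where p: "geodesic p r" "p 0 = a" "p r = x"
    using geodesic_exists[OF assms(3)] .
  obtain q where q: "geodesic q r" "q 0 = a" "q r = y"
    using geodesic_exists[OF assms(4)] .
  have d: "dst a (p (r - 1)) = r - 1" "dst a (q (r - 1)) = r - 1"
    using p q by (auto simp: geodesic_def)
  have "p (r - 1) \<noteq> y" "q (r - 1) \<noteq> x" if "r > 0"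
    using assms that d by auto
  then obtain c where "is_cycle E c" "length c \<le> r + r + 1"
    using cycle_of_two_geodesics[of p r q r] p q assms(2) by auto
  then show ?thesis using g by (force simp: has_girth_def)
qed

lemma two_neighbours_of_girth:
  assumes "has_girth E g"
  obtains u v v' where "E u v" "E u v'" "v \<noteq> v'"
proof -
  obtain c where c: "is_cycle E c" using assms by (auto simp: has_girth_def)
  then have c3: "3 \<le> length c" and E: "\<And>i. i < length c \<Longrightarrow> E (c ! i) (c ! (Suc i mod length c))"
    by (auto simp: is_cycle_def)
  have "Suc 0 mod length c = 1" "Suc 1 mod length c = 2" using c3 by (auto simp: eval_nat_numeral)
  then have "E (c ! 0) (c ! 1)" "E (c ! 1) (c ! 2)"
    using E[of 0] E[of 1] c3 by (cases c, auto simp: eval_nat_numeral)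
  moreover have "c ! 0 \<noteq> c ! 2" 
  proof
    have "distinct c" "0 < length c" "2 < length c" using c c3 unfolding is_cycle_def by auto
    moreover assume "c ! 0 = c ! 2"
    ultimately show False using nth_eq_iff_index_eq[of c 0 2] by simp
  qed
  ultimately show thesis using that E_sym by blast
qed

lemma degree_ge_2:
  assumes "regular_graph E d" "has_girth E g"
  shows "2 \<le> d"
proof -
  obtain u v v' where v: "E u v" "E u v'" "v \<noteq> v'" using two_neighbours_of_girth[OF assms(2)] .
  then have "card {v, v'} \<le> card {w. E u w}" by (intro card_mono) auto
  with v assms(1) show ?thesis by (simp add: regular_graph_def vertex_degree_def)
qed

lemma diameter_attained:
  assumes "has_diameter E D"
  obtains u v where "dst u v = D"
proof -
  have "D \<in> range (\<lambda>(u, v). dst u v)"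
    using assms Max_in[of "range (\<lambda>(u, v). dst u v)"] by (simp add: has_diameter_def)
  then show thesis using that by auto
qed

end

section \<open>Radial functions around two distant vertices\<close>

context finite_connected_graph
begin

definition ball_function :: "nat \<Rightarrow> (nat \<Rightarrow> real) \<Rightarrow> 'v \<Rightarrow> 'v \<Rightarrow> real" where
  "ball_function K f u x = (if dst u x < K then f (dst u x) else 0)"

text \<open>The crucial estimate is that the signed sum of the two functions at each neighbour of \<open>x\<close> is at least
the value \<open>f (r + 1)\<close>, where \<open>r\<close> is the distance of \<open>x\<close> from \<open>u\<close>. Neighbours in the ball around \<open>u\<close> satisfy
it because \<open>f\<close> decreases, and vertices outside both balls because \<open>f K \<le> 0\<close>. A neighbour in the ball
around \<open>v\<close> is possible only if the distance of the centres is \<open>2 * K - 1\<close> and both vertices lie on the boundary of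
their balls; then the value is \<open>- f (K - 1)\<close>. One neighbour is at distance \<open>r - 1\<close> and contributes
\<open>f (r - 1)\<close>, so the worst case is that of a tree.\<close>

lemma ball_function_Rayleigh:
  assumes reg: "regular_graph E d"
    and K: "2 * K \<le> dst u v + 1"
    and neg: "f K \<le> 0"
    and meet: "dst u v < 2 * K \<Longrightarrow> f K \<le> - f (K - 1)"
    and dec: "\<And>r. r < K \<Longrightarrow> f (Suc r) \<le> f r"
    and centre: "\<mu> * f 0 \<le> real d * f 1"
    and rec: "\<And>r. 0 < r \<Longrightarrow> r < K \<Longrightarrow> \<mu> * f r \<le> f (r - 1) + (real d - 1) * f (Suc r)"
    and x: "dst u x < K"
  shows "\<mu> * ball_function K f u x \<le> (\<Sum>y | E x y. ball_function K f u y - ball_function K f v y)"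
proof -
  let ?F = "\<lambda>y. ball_function K f u y - ball_function K f v y"
  let ?N = "{y. E x y}"
  have card: "card ?N = d" using reg by (simp add: regular_graph_def vertex_degree_def)
  define r where "r = dst u x"
  have anti: "f j \<le> f i" if "i \<le> j" "j \<le> K" for i j
    using that
  proof (induction rule: dec_induct)
    case (step n)
    then show ?case using dec[of n] by force
  qed simp
  have tri: "dst u v \<le> dst u y + dst v y" for y
    using dst_triangle[of u v y] by (simp add: dst_commute)
  have low: "f (Suc r) \<le> ?F y" if "y \<in> ?N" for y
  proof -
    have y: "dst u y \<le> Suc r" using that dst_step[of x y u] by (simp add: r_def)
    show ?thesis
    proof (cases "dst v y < K")
      case True
      have *: "dst u v < 2 * K" "Suc r = K" "dst v y = K - 1" "\<not> dst u y < K"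
        using tri[of y] True y x K by (auto simp: r_def)
      then show ?thesis using meet by (simp add: ball_function_def x)
    next
      case False
      then show ?thesis
        using anti[of "dst u y" "Suc r"] y x anti[of "Suc r" K] neg
        by (cases "Suc r = K") (auto simp: ball_function_def r_def not_less)
    qed
  qed
  show ?thesis
  proof (cases "r = 0")
    case True
    have "\<mu> * f 0 \<le> (\<Sum>y\<in>?N. f (Suc r))" using centre True by (simp add: card)
    also have "\<dots> \<le> sum ?F ?N" by (intro sum_mono low)
    finally have "\<mu> * f r \<le> sum ?F ?N" using True by simp
    then show ?thesis using x by (simp add: ball_function_def r_def)
  next
    case False
    then obtain k where k: "r = Suc k" by (cases r) auto
    then obtain y0 where y0: "E x y0" "dst u y0 = k" using predecessor[of u x k] r_def by auto
    have "?F y0 = f k"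
      using tri[of y0] y0 k x K by (auto simp: ball_function_def r_def)
    have "d > 0" using y0 card by (metis card_gt_0_iff empty_iff finite mem_Collect_eq)
    have "\<mu> * f r \<le> f k + (real d - 1) * f (Suc r)" using rec[of r] k x r_def by simp
    also have "\<dots> = ?F y0 + (\<Sum>y\<in>?N - {y0}. f (Suc r))"
      using y0 \<open>d > 0\<close> by (simp add: \<open>?F y0 = f k\<close> card_Diff_singleton card of_nat_diff)
    also have "\<dots> \<le> ?F y0 + sum ?F (?N - {y0})"
      by (intro add_left_mono sum_mono low) auto
    also have "\<dots> = sum ?F ?N" using y0 by (simp add: sum.remove[of ?N y0])
    finally show ?thesis using x by (simp add: ball_function_def r_def)
  qed
qed

text \<open>A positive profile that satisfies the recursion of the \<open>d\<close>-regular tree exactly is decreasing: the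
recursion reads \<open>(d - 1) * (f (r + 1) - f r) = (\<mu> - d) * f r - (f (r - 1) - f r)\<close>, and \<open>\<mu> \<le> d\<close>, so each
step down leads to the next one.\<close>

lemma algebraic_connectivity_le_diameter:
  assumes reg: "regular_graph E d"
    and K: "0 < K" "2 * K \<le> dst u v + 1"
    and pos: "\<And>r. r < K \<Longrightarrow> 0 < f r" and neg: "f K \<le> 0"
    and meet: "dst u v < 2 * K \<Longrightarrow> f K \<le> - f (K - 1)"
    and \<mu>: "\<mu> \<le> real d" and d: "2 \<le> d"
    and centre: "\<mu> * f 0 = real d * f 1"
    and rec: "\<And>r. 0 < r \<Longrightarrow> r < K \<Longrightarrow> \<mu> * f r = f (r - 1) + (real d - 1) * f (Suc r)"
  shows "algebraic_connectivity E \<le> real d - \<mu>"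
proof -
  have dec: "f (Suc r) \<le> f r" if "r < K" for r
    using that
  proof (induction r)
    case 0
    then have "\<mu> * f 0 \<le> real d * f 0" using \<mu> pos[of 0] by (intro mult_right_mono) auto
    then have "real d * f 1 \<le> real d * f 0" by (simp only: centre)
    then show ?case using d by simp
  next
    case (Suc r)
    then have "f (Suc r) \<le> f r" by simp
    have "(real d - 1) * f (Suc (Suc r)) = \<mu> * f (Suc r) - f r" using rec[of "Suc r"] Suc by simp
    also have "\<dots> \<le> real d * f (Suc r) - f (Suc r)"
      using \<mu> pos[of "Suc r"] Suc \<open>f (Suc r) \<le> f r\<close> by (intro diff_mono mult_right_mono) auto
    finally have *: "(real d - 1) * f (Suc (Suc r)) \<le> (real d - 1) * f (Suc r)" by (simp add: algebra_simps)
    then show ?case using d by (simp add: mult_le_cancel_left)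
  qed
  have tri: "dst u v \<le> dst u y + dst v y" for y
    using dst_triangle[of u v y] by (simp add: dst_commute)
  let ?F = "ball_function K f"
  have nz: "?F w x \<noteq> 0 \<Longrightarrow> dst w x < K" for w x by (auto simp: ball_function_def split: if_splits)
  have side: "\<mu> * ?F a x \<le> (\<Sum>y | E x y. ?F a y - ?F b y)"
    if "?F a x \<noteq> 0" "dst a b = dst u v" for a b x
    using that K pos neg meet dec centre rec nz
    by (intro ball_function_Rayleigh[OF reg]) (auto intro: less_imp_le)
  show ?thesis
  proof (rule algebraic_connectivity_le_two_functions[OF simple reg conn])
    show "0 \<le> ?F u x" "0 \<le> ?F v x" for x using pos by (auto simp: ball_function_def intro: less_imp_le)
    show "?F u x = 0 \<or> ?F v x = 0" for x using tri[of x] K by (auto simp: ball_function_def)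
    show "?F u u \<noteq> 0" "?F v v \<noteq> 0" using pos[of 0] K by (auto simp: ball_function_def)
    show "\<mu> * ?F u x \<le> (\<Sum>y | E x y. ?F u y - ?F v y)" if "?F u x \<noteq> 0" for x
      using side[OF that] by simp
    show "\<mu> * ?F v x \<le> (\<Sum>y | E x y. ?F v y - ?F u y)" if "?F v x \<noteq> 0" for x
      using side[OF that] dst_commute by simp
  qed
qed

text \<open>The indicator functions of two vertices serve for diameter 1, where the balls degenerate to their
centres.\<close>

lemma algebraic_connectivity_le_degree_plus_1:
  fixes u v :: 'v
  assumes reg: "regular_graph E d" and "u \<noteq> v"
  shows "algebraic_connectivity E \<le> real d + 1"
proof -
  have *: "-1 \<le> (\<Sum>y | E a y. of_bool (y = a) - of_bool (y = b) :: real)" for a b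
    using E_irrefl[of a] card_mono[of "{b}" "Collect (E a) \<inter> {b}"] by (simp add: sum_subtractf)
  have "algebraic_connectivity E \<le> real d - (-1)"
    using assms(2) * by (intro algebraic_connectivity_le_two_functions[OF simple reg conn,
        of "\<lambda>y. of_bool (y = u)" "\<lambda>y. of_bool (y = v)" u v])
      auto
  then show ?thesis by simp
qed

end

section \<open>Functions on two branches at a vertex\<close>

context finite_connected_graph
begin

text \<open>The vertices that a shortest path from \<open>u\<close> of length at most \<open>L\<close> reaches through its neighbour \<open>v\<close>.
When \<open>2 * L < g\<close> this is a \<open>(d - 1)\<close>-ary tree rooted at \<open>v\<close>.\<close>

definition branch :: "nat \<Rightarrow> 'v \<Rightarrow> 'v \<Rightarrow> 'v set" where
  "branch L u v = {x. dst u x \<le> L \<and> dst u x = Suc (dst v x)}"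

definition branch_function :: "nat \<Rightarrow> (nat \<Rightarrow> real) \<Rightarrow> 'v \<Rightarrow> 'v \<Rightarrow> 'v \<Rightarrow> real" where
  "branch_function L f u v x = (if x \<in> branch L u v then f (dst u x) else 0)"

text \<open>Seen from a common vertex \<open>x\<close>, the vertex \<open>u\<close> would have the two predecessors \<open>v\<close> and \<open>v'\<close>.\<close>

lemma branches_disjoint:
  assumes "has_girth E g" "2 * L < g" "E u v" "E u v'" "v \<noteq> v'" "x \<in> branch L u v"
  shows "x \<notin> branch L u v'"
proof
  assume "x \<in> branch L u v'"
  then have *: "dst x u = Suc (dst v x)" "dst x v = dst v x" "dst x v' = dst v x" "dst x u \<le> L"
    using assms(6) dst_commute[of x] by (simp_all add: branch_def)
  have "g \<le> 2 * Suc (dst v x)"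
    by (rule girth_le_two_predecessors[OF assms(1) *(1) assms(3-5) *(2,3)])
  with *(1,4) assms(2) show False by simp
qed

text \<open>Two leaves of one branch that are both adjacent to \<open>x\<close> close up inside the branch already, that is, at
its root \<open>v\<close> and not only at \<open>u\<close>. This saves two edges and brings the length of the cycle down to at most \<open>2 * L\<close>.\<close>

lemma branch_unique_neighbour:
  assumes g: "has_girth E g" "2 * L < g" and v: "E u v"
    and x: "dst u x = L" and y: "E x y" "y \<in> branch L u v" "dst u y = L"
    and y': "E x y'" "y' \<in> branch L u v" "dst u y' = L"
  shows "y = y'"
proof (rule ccontr)
  assume "y \<noteq> y'"
  obtain k where k: "L = Suc k" "dst v y = k" "dst v y' = k" using y y' by (auto simp: branch_def)
  have "dst v x \<le> Suc k" using dst_step[of y x v] y k E_sym by auto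
  moreover have "k \<le> dst v x" using dst_triangle[of u x v] dst_adj[OF v] x k by simp
  ultimately consider "dst v x = Suc k" | "dst v x = k" by linarith
  then show False
  proof cases
    case 1
    then show False
      using girth_le_two_predecessors[OF g(1), of v x k y y'] y y' k g \<open>y \<noteq> y'\<close> by auto
  next
    case 2
    then show False using girth_le_level_edge[OF g(1), of x y v k] y k g by auto
  qed
qed

text \<open>Inside the tree the sum is exactly \<open>f (r - 1) + (d - 1) * f (r + 1)\<close>; the vertex \<open>u\<close>, where all branches
meet, counts as \<open>f 0 = 0\<close>. A leaf can be adjacent to leaves of the other branch only if the girth is
\<open>2 * L + 1\<close>, and then to at most one of them, which costs \<open>f L\<close>.\<close>

lemma branch_function_Rayleigh:
  assumes reg: "regular_graph E d" and g: "has_girth E g" "2 * L < g"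
    and v: "E u v" "E u v'" "v \<noteq> v'"
    and f0: "f 0 = 0" and pos: "\<And>r. 0 < r \<Longrightarrow> r \<le> L \<Longrightarrow> 0 \<le> f r"
    and rec: "\<And>r. 0 < r \<Longrightarrow> r < L \<Longrightarrow> \<mu> * f r \<le> f (r - 1) + (real d - 1) * f (Suc r)"
    and leaf: "\<mu> * f L \<le> f (L - 1) - (if 2 * L + 1 < g then 0 else f L)"
    and x: "x \<in> branch L u v"
  shows "\<mu> * branch_function L f u v x
    \<le> (\<Sum>y | E x y. branch_function L f u v y - branch_function L f u v' y)"
proof -
  let ?F = "branch_function L f u"
  let ?N = "{y. E x y}"
  have card: "card ?N = d" using reg by (simp add: regular_graph_def vertex_degree_def)
  note disj = branches_disjoint[OF g v]
  obtain k where k: "dst u x = Suc k" "dst v x = k" "Suc k \<le> L" using x by (auto simp: branch_def)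
  obtain y0 where y0: "E x y0" "dst u y0 = k" "?F v y0 - ?F v' y0 = f k"
  proof (cases k)
    case 0
    then obtain y where "E x y" "dst u y = 0" using predecessor[of u x 0] k by auto
    moreover from this have "?F v y - ?F v' y = 0" by (simp add: branch_function_def branch_def)
    ultimately show thesis using that 0 f0 by auto
  next
    case (Suc j)
    then obtain y where y: "E x y" "dst v y = j" using predecessor[of v x j] k by auto
    have "dst u y \<le> k" using dst_triangle[of u y v] dst_adj[OF v(1)] y Suc by simp
    moreover have "Suc k \<le> Suc (dst u y)" using dst_step[of y x u] y k E_sym by auto
    ultimately have *: "dst u y = k" by simp
    then have "y \<in> branch L u v" using y k Suc by (simp add: branch_def)
    with disj[of y] * y that show thesis by (auto simp: branch_function_def)
  qed
  have d: "d > 0" using y0 card by (metis card_gt_0_iff empty_iff finite mem_Collect_eq)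
  have other: "k < dst u y" if "y \<in> ?N - {y0}" for y
  proof -
    have "dst u y \<noteq> k"
      using girth_le_two_predecessors[OF g(1), of u x k y y0] that y0 k g by auto
    moreover have "k \<le> dst u y" using dst_step[of y x u] that k E_sym by auto
    ultimately show ?thesis by simp
  qed
  have split: "(\<Sum>y\<in>?N. ?F v y - ?F v' y) = f k + (\<Sum>y\<in>?N - {y0}. ?F v y - ?F v' y)"
    using y0 by (simp add: sum.remove[of ?N y0])
  have Fx: "?F v x = f (Suc k)" using x k by (simp add: branch_function_def)
  show ?thesis
  proof (cases "Suc k < L")
    case True
    have "?F v y - ?F v' y = f (Suc (Suc k))" if y: "y \<in> ?N - {y0}" for y
    proof -
      have "dst u y \<noteq> Suc k"
        using girth_le_level_edge[OF g(1), of x y u "Suc k"] y k True g by auto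
      then have uy: "dst u y = Suc (Suc k)" using other[OF y] dst_step[of x y u] y k by auto
      moreover have "dst v y \<le> Suc k" using dst_step[of x y v] y k by auto
      moreover have "dst u y \<le> Suc (dst v y)"
        using dst_triangle[of u y v] dst_adj[OF v(1)] by simp
      ultimately have "y \<in> branch L u v" using True by (simp add: branch_def)
      then show ?thesis using disj[of y] uy by (simp add: branch_function_def)
    qed
    then have "(\<Sum>y\<in>?N - {y0}. ?F v y - ?F v' y) = (\<Sum>y\<in>?N - {y0}. f (Suc (Suc k)))"
      by (intro sum.cong refl)
    also have "\<dots> = (real d - 1) * f (Suc (Suc k))"
      using d y0 by (simp add: card_Diff_singleton card of_nat_diff)
    finally show ?thesis unfolding split Fx using rec[of "Suc k"] True by simp
  next
    case False
    then have kL: "Suc k = L" using k by simp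
    define S where "S = {y \<in> ?N - {y0}. y \<in> branch L u v'}"
    have SL: "dst u y = L" if "y \<in> S" for y
      using that other[of y] kL by (auto simp: S_def branch_def)
    have "card S \<le> (if 2 * L + 1 < g then 0 else 1)"
    proof (cases "2 * L + 1 < g")
      case True
      have "S = {}"
        using SL girth_le_level_edge[OF g(1), of x _ u L] True k kL by (force simp: S_def)
      then show ?thesis by simp
    next
      case False
      have "y = y'" if "y \<in> S" "y' \<in> S" for y y'
        using branch_unique_neighbour[OF g v(2), of x y y'] that SL k kL by (auto simp: S_def)
      then have "card S \<le> 1" by (simp add: card_le_Suc0_iff_eq)
      then show ?thesis using False by simp
    qed
    then have "real (card S) * f L \<le> (if 2 * L + 1 < g then 0 else 1) * f L"
      using pos[of L] kL by (intro mult_right_mono) (auto split: if_splits)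
    moreover have "(\<Sum>y\<in>?N - {y0}. ?F v' y) = real (card S) * f L"
    proof -
      have "(\<Sum>y\<in>?N - {y0}. ?F v' y) = (\<Sum>y\<in>S. ?F v' y)"
        by (rule sum.mono_neutral_right) (auto simp: S_def branch_function_def)
      also have "\<dots> = (\<Sum>y\<in>S. f L)"
        using SL by (intro sum.cong) (auto simp: S_def branch_function_def)
      finally show ?thesis by simp
    qed
    moreover have "0 \<le> (\<Sum>y\<in>?N - {y0}. ?F v y)"
      using pos by (intro sum_nonneg) (auto simp: branch_function_def branch_def)
    ultimately have "- (if 2 * L + 1 < g then 0 else f L) \<le> (\<Sum>y\<in>?N - {y0}. ?F v y - ?F v' y)"
      by (auto simp: sum_subtractf split: if_splits)
    then show ?thesis unfolding split Fx using leaf kL by auto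
  qed
qed

lemma algebraic_connectivity_le_girth:
  assumes reg: "regular_graph E d" and g: "has_girth E g" "0 < L" "2 * L < g"
    and f0: "f 0 = 0" and pos: "\<And>r. 0 < r \<Longrightarrow> r \<le> L \<Longrightarrow> 0 < f r"
    and rec: "\<And>r. 0 < r \<Longrightarrow> r < L \<Longrightarrow> \<mu> * f r = f (r - 1) + (real d - 1) * f (Suc r)"
    and leaf: "\<mu> * f L \<le> f (L - 1) - (if 2 * L + 1 < g then 0 else f L)"
  shows "algebraic_connectivity E \<le> real d - \<mu>"
proof -
  obtain u v v' where v: "E u v" "E u v'" "v \<noteq> v'" using two_neighbours_of_girth[OF g(1)] .
  let ?F = "branch_function L f u"
  have nz: "?F w x \<noteq> 0 \<Longrightarrow> x \<in> branch L u w" for w x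
    by (auto simp: branch_function_def split: if_splits)
  have side: "\<mu> * ?F a x \<le> (\<Sum>y | E x y. ?F a y - ?F b y)"
    if "?F a x \<noteq> 0" "E u a" "E u b" "a \<noteq> b" for a b x
    using that g f0 pos rec leaf nz
    by (intro branch_function_Rayleigh[OF reg g(1,3)]) (auto intro: less_imp_le)
  show ?thesis
  proof (rule algebraic_connectivity_le_two_functions[OF simple reg conn])
    show "0 \<le> ?F v x" "0 \<le> ?F v' x" for x
      using pos by (auto simp: branch_function_def branch_def intro: less_imp_le)
    show "?F v x = 0 \<or> ?F v' x = 0" for x
      using branches_disjoint[OF g(1,3) v] by (auto simp: branch_function_def)
    show "?F v v \<noteq> 0" "?F v' v' \<noteq> 0"
      using pos[of 1] g v dst_adj by (auto simp: branch_function_def branch_def)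
    show "\<mu> * ?F v x \<le> (\<Sum>y | E x y. ?F v y - ?F v' y)" if "?F v x \<noteq> 0" for x
      using side[OF that v] .
    show "\<mu> * ?F v' x \<le> (\<Sum>y | E x y. ?F v' y - ?F v y)" if "?F v' x \<noteq> 0" for x
      using side[OF that v(2,1)] v(3) by simp
  qed
qed

end

section \<open>The smallest positive roots\<close>

text \<open>The function \<open>G\<close> is the equation cleared of denominators. It is continuous, unlike the tangents and
quotients, and need agree with the equation only to the left of a known bound \<open>c\<close>.\<close>

lemma smallest_positive_root_exists:
  fixes G :: "real \<Rightarrow> real"
  assumes cont: "continuous_on UNIV G" and a: "0 < a"
    and pos: "\<And>t. 0 < t \<Longrightarrow> t < a \<Longrightarrow> 0 < G t"
    and b: "a \<le> b" "b \<le> c" "G b \<le> 0" "G b < 0 \<or> b < c"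
    and eqn: "\<And>t. 0 < t \<Longrightarrow> t < c \<Longrightarrow> eqn t \<longleftrightarrow> G t = 0"
  shows "\<exists>\<theta>. smallest_positive_root eqn \<theta> \<and> \<theta> < c \<and> G \<theta> = 0"
proof -
  define S where "S = {a / 2..b} \<inter> G -` {0}"
  have "continuous_on {a / 2..b} G" using cont continuous_on_subset by blast
  then have "\<exists>x\<ge>a / 2. x \<le> b \<and> G x = 0" using pos[of "a / 2"] a b by (intro IVT2') auto
  then have "S \<noteq> {}" unfolding S_def by auto
  moreover have "compact S"
    unfolding S_def using cont by (intro compact_Int_closed closed_vimage) auto
  ultimately obtain \<theta> where \<theta>: "\<theta> \<in> S" "\<And>t. t \<in> S \<Longrightarrow> \<theta> \<le> t"
    using compact_attains_inf[of S] by auto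
  have "0 < \<theta>" "\<theta> \<le> b" "G \<theta> = 0" using \<theta>(1) a by (auto simp: S_def)
  moreover from this have "\<theta> < c" using b by (cases "\<theta> = b") auto
  moreover have "\<theta> \<le> t" if "0 < t" "eqn t" for t
  proof (cases "t \<le> b \<and> t < c")
    case True
    then have "G t = 0" using that eqn by blast
    then have "a \<le> t" using pos[of t] that by force
    then have "t \<in> S" using a True \<open>G t = 0\<close> by (auto simp: S_def)
    then show ?thesis by (rule \<theta>(2))
  next
    case False
    then show ?thesis using \<open>\<theta> < c\<close> \<open>\<theta> \<le> b\<close> by linarith
  qed
  ultimately have "smallest_positive_root eqn \<theta>" using eqn[of \<theta>] by (auto simp: smallest_positive_root_def)
  with \<open>\<theta> < c\<close> \<open>G \<theta> = 0\<close> show ?thesis by blast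
qed

text \<open>In the next three lemmas \<open>sx\<close>, \<open>cx\<close>, \<open>st\<close> and \<open>ct\<close> stand for the sines and cosines of \<open>t * K\<close> and \<open>t\<close>. The
degenerate denominators are the reason for separate cases: with \<open>x / 0 = 0\<close> both sides remain
equivalent there.\<close>

lemma even_diameter_equation_iff:
  fixes d :: real
  assumes "2 \<le> d" "0 < sx" "0 < st" "0 < ct"
  shows "sx / cx = - (d / (d - 2)) * (st / ct) \<longleftrightarrow> d * st * cx + (d - 2) * ct * sx = 0"
proof (cases "cx = 0 \<or> d = 2")
  case True
  then show ?thesis using assms by auto
next
  case False
  then have "d - 2 \<noteq> 0" "cx \<noteq> 0" by auto
  then have "sx / cx = - (d * st) / ((d - 2) * ct)
      \<longleftrightarrow> sx * ((d - 2) * ct) = - (d * st) * cx"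
    using assms by (intro frac_eq_eq) auto
  then show ?thesis by (simp add: algebra_simps)
qed

text \<open>The denominator factors as \<open>(s - ct) * (2 * s * ct + d)\<close>. The second factor cancels, so the equation is
just \<open>tan (t * K) = - sin t / (s - cos t)\<close>.\<close>

lemma odd_diameter_equation_iff:
  fixes s :: real
  assumes "1 \<le> s" "d = s\<^sup>2 + 1" "0 < sx" "0 < st" "st\<^sup>2 + ct\<^sup>2 = 1"
  shows "sx / cx = - (((2 * s * ct + d) * st) / (s * (d - 2 * ct\<^sup>2) + (d - 2) * ct))
    \<longleftrightarrow> s * sx = sx * ct - cx * st"
proof -
  let ?M = "2 * s * ct + d"
  have "?M = (s + ct)\<^sup>2 + st\<^sup>2" using assms by (simp add: power2_sum)
  then have M: "?M > 0" using assms by (simp add: add_nonneg_pos)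
  have "s * (d - 2 * ct\<^sup>2) + (d - 2) * ct = (s - ct) * ?M"
    using assms(2) by (simp add: power2_eq_square algebra_simps)
  then have "((2 * s * ct + d) * st) / (s * (d - 2 * ct\<^sup>2) + (d - 2) * ct) = st / (s - ct)"
    using M by (simp add: mult.commute)
  moreover have "ct\<^sup>2 < 1" using assms by (smt (verit) zero_less_power)
  then have "ct < 1" by (simp add: abs_square_less_1)
  then have sc: "s - ct > 0" using assms by linarith
  moreover have "sx / cx = - (st / (s - ct)) \<longleftrightarrow> s * sx = sx * ct - cx * st"
  proof (cases "cx = 0")
    case True
    then show ?thesis using assms sc by auto
  next
    case False
    then have "sx / cx = - st / (s - ct) \<longleftrightarrow> sx * (s - ct) = - st * cx"
      using sc by (intro frac_eq_eq) auto
    then show ?thesis by (auto simp: algebra_simps)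
  qed
  ultimately show ?thesis by simp
qed

lemma odd_girth_equation_iff:
  fixes p :: real
  assumes "0 < sx" "0 < st"
  shows "sx / cx = - (st / (p + ct)) \<longleftrightarrow> sx * ct + cx * st + p * sx = 0"
proof (cases "cx = 0 \<or> p + ct = 0")
  case True
  then show ?thesis
  proof
    assume "cx = 0"
    then have "sx * ct + cx * st + p * sx = sx * (p + ct)" by (simp add: algebra_simps)
    then show ?thesis using assms \<open>cx = 0\<close> by auto
  next
    assume "p + ct = 0"
    then have "p = - ct" by simp
    then show ?thesis using assms by auto
  qed
next
  case False
  then have "sx / cx = - st / (p + ct) \<longleftrightarrow> sx * (p + ct) = - st * cx"
    by (intro frac_eq_eq) auto
  then show ?thesis by (auto simp: algebra_simps)
qed

lemma small_angle:
  fixes t :: real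
  assumes "0 < K" "0 < t" "t < pi / real K"
  shows "0 < t * real K" "t * real K < pi" "t < pi"
proof -
  show 1: "0 < t * real K" "t * real K < pi" using assms by (auto simp: field_simps)
  have "t * 1 \<le> t * real K" using assms by (intro mult_left_mono) auto
  with 1 show "t < pi" by simp
qed

lemma smaller_angle:
  fixes t :: real
  assumes "0 < K" "0 < t" "t < pi / (2 * real K)"
  shows "t * real K < pi / 2" "t < pi / 2"
proof -
  show 1: "t * real K < pi / 2" using assms by (auto simp: field_simps)
  have "t * 1 \<le> t * real K" using assms by (intro mult_left_mono) auto
  with 1 show "t < pi / 2" by simp
qed

lemma half_angle:
  fixes t :: real
  assumes "2 \<le> K" "0 < t" "t < pi / real K"
  shows "t < pi / 2"
proof -
  have "pi / real K \<le> pi / 2" using assms by (intro divide_left_mono) auto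
  with assms show ?thesis by linarith
qed

text \<open>The cleared left-hand side is positive before \<open>pi / (2 * K)\<close>. For \<open>K \<ge> 2\<close> it is negative at \<open>pi / K\<close>;
for \<open>K = 1\<close> it is a multiple of \<open>sin t * cos t\<close>.\<close>

lemma even_diameter_root:
  assumes d: "2 \<le> d" and K: "0 < K"
  shows "\<exists>\<theta>. smallest_positive_root (\<lambda>t. tan (t * real K) = - (real d / (real d - 2)) * tan t) \<theta>
    \<and> \<theta> < pi / real K
    \<and> real d * sin \<theta> * cos (\<theta> * real K) + (real d - 2) * cos \<theta> * sin (\<theta> * real K) = 0"
proof (rule smallest_positive_root_exists[of
      "\<lambda>t. real d * sin t * cos (t * real K) + (real d - 2) * cos t * sin (t * real K)"
      "pi / (2 * real K)" "if K = 1 then pi / 2 else pi / real K" "pi / real K"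
      "\<lambda>t. tan (t * real K) = - (real d / (real d - 2)) * tan t"])
  let ?G = "\<lambda>t. real d * sin t * cos (t * real K) + (real d - 2) * cos t * sin (t * real K)"
  show "continuous_on UNIV ?G" by (intro continuous_intros)
  show "0 < ?G t" if "0 < t" "t < pi / (2 * real K)" for t
    using smaller_angle[OF K that] that K d
    by (intro add_pos_nonneg mult_pos_pos mult_nonneg_nonneg sin_gt_zero cos_gt_zero cos_ge_zero sin_ge_zero) auto
  show "(tan (t * real K) = - (real d / (real d - 2)) * tan t) \<longleftrightarrow> ?G t = 0"
    if t: "0 < t" "t < pi / real K" for t
  proof -
    note a = small_angle[OF K t]
    have pos: "0 < sin (t * real K)" "0 < sin t" using a t by (auto intro: sin_gt_zero)
    show ?thesis
    proof (cases "K = 1")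
      case True
      have "(tan t = - (real d / (real d - 2)) * tan t) \<longleftrightarrow> tan t * (1 + real d / (real d - 2)) = 0"
        by (simp add: algebra_simps) argo
      moreover have "1 + real d / (real d - 2) > 0" using d by (intro add_pos_nonneg) auto
      moreover have "tan t = 0 \<longleftrightarrow> cos t = 0" using pos by (simp add: tan_def)
      moreover have "?G t = (2 * real d - 2) * sin t * cos t" using True by (simp add: algebra_simps)
      ultimately show ?thesis using True pos d by simp
    next
      case False
      then have "0 < cos t" using half_angle[of K t] t K by (intro cos_gt_zero) auto
      then show ?thesis
        unfolding tan_def using d pos by (intro even_diameter_equation_iff) auto
    qed
  qed
  have "?G (pi / 2) = 0" if "K = 1" using that by simp
  moreover have "?G (pi / real K) < 0" if "K \<noteq> 1"
  proof -
    have "0 < sin (pi / real K)" using that K by (intro sin_gt_zero) (auto simp: field_simps)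
    then show ?thesis using K d by simp
  qed
  ultimately show "?G (if K = 1 then pi / 2 else pi / real K) \<le> 0"
    "?G (if K = 1 then pi / 2 else pi / real K) < 0 \<or> (if K = 1 then pi / 2 else pi / real K) < pi / real K"
    by (auto simp del: mult_eq_0_iff)
qed (use K in \<open>auto simp: field_simps\<close>)

lemma odd_diameter_equation_cleared:
  assumes d: "2 \<le> d" and K: "0 < K" and t: "0 < t" "t < pi / real K"
  shows "tan (t * real K) =
       - (((2 * sqrt (real d - 1) * cos t + real d) * sin t) /
          (sqrt (real d - 1) * (real d - 2 * (cos t)\<^sup>2) + (real d - 2) * cos t))
    \<longleftrightarrow> sqrt (real d - 1) * sin (t * real K) = sin (t * real K) * cos t - cos (t * real K) * sin t"
  unfolding tan_def using d t small_angle[OF K t]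
  by (intro odd_diameter_equation_iff) (auto intro: sin_gt_zero)

lemma odd_diameter_root:
  assumes d: "2 \<le> d" and K: "2 \<le> K"
  shows "\<exists>\<theta>. smallest_positive_root
       (\<lambda>t. tan (t * real K) =
          - (((2 * sqrt (real d - 1) * cos t + real d) * sin t) /
             (sqrt (real d - 1) * (real d - 2 * (cos t)\<^sup>2) + (real d - 2) * cos t))) \<theta>
    \<and> \<theta> < pi / real K
    \<and> sqrt (real d - 1) * sin (\<theta> * real K) - (sin (\<theta> * real K) * cos \<theta> - cos (\<theta> * real K) * sin \<theta>) = 0"
proof -
  let ?s = "sqrt (real d - 1)"
  let ?G = "\<lambda>t. ?s * sin (t * real K) - (sin (t * real K) * cos t - cos (t * real K) * sin t)"
  have K0: "0 < K" and s: "1 \<le> ?s" using K d by auto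
  show ?thesis
  proof (rule smallest_positive_root_exists[of ?G "pi / (2 * real K)" "pi / real K" "pi / real K"])
    show "continuous_on UNIV ?G" by (intro continuous_intros)
    show "0 < ?G t" if "0 < t" "t < pi / (2 * real K)" for t
    proof -
      note a = smaller_angle[OF K0 that]
      have "0 < sin (t * real K)" "0 < cos (t * real K)" "0 < sin t"
        using a that K by (auto intro!: sin_gt_zero cos_gt_zero)
      then have "0 < cos (t * real K) * sin t" "0 \<le> sin (t * real K) * (?s - cos t)"
        using order_trans[OF cos_le_one s] by (auto intro!: mult_nonneg_nonneg)
      then show ?thesis by (simp add: algebra_simps)
    qed
    have "0 < sin (pi / real K)" using K by (intro sin_gt_zero) (auto simp: field_simps)
    then show "?G (pi / real K) < 0 \<or> pi / real K < pi / real K" "?G (pi / real K) \<le> 0"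
      using K by auto
    show "(tan (t * real K) =
          - (((2 * ?s * cos t + real d) * sin t) /
             (?s * (real d - 2 * (cos t)\<^sup>2) + (real d - 2) * cos t))) \<longleftrightarrow> ?G t = 0"
      if "0 < t" "t < pi / real K" for t
      using odd_diameter_equation_cleared[OF d K0 that] by simp
  qed (use K in \<open>auto simp: field_simps\<close>)
qed

text \<open>For \<open>K = 1\<close> the cleared equation reduces to \<open>sqrt (d - 1) * sin t = 0\<close>.\<close>

lemma odd_diameter_one_root:
  assumes d: "2 \<le> d"
  shows "smallest_positive_root
       (\<lambda>t. tan (t * real 1) =
          - (((2 * sqrt (real d - 1) * cos t + real d) * sin t) /
             (sqrt (real d - 1) * (real d - 2 * (cos t)\<^sup>2) + (real d - 2) * cos t))) pi"
proof -
  have "\<not> sqrt (real d - 1) * sin t = sin t * cos t - cos t * sin t" if "0 < t" "t < pi" for t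
    using sin_gt_zero[OF that] d by simp
  then show ?thesis
    using odd_diameter_equation_cleared[OF d, of 1]
    pi_gt_zero
    unfolding smallest_positive_root_def by (auto simp: not_le[symmetric])
qed

text \<open>For \<open>K \<ge> 2\<close> the cleared left-hand side is negative at \<open>pi / K\<close>. For \<open>K = 1\<close> it vanishes there, but it equals
\<open>sin t * (2 * cos t + p)\<close> with \<open>p \<le> 1\<close> and is nonpositive already at \<open>2 * pi / 3\<close>.\<close>

lemma odd_girth_root:
  assumes d: "2 \<le> d" and K: "0 < K"
  shows "\<exists>\<theta>. smallest_positive_root
       (\<lambda>t. tan (t * real K) = - (sin t / ((real d - 1) powr (- (1 / 2)) + cos t))) \<theta>
    \<and> \<theta> < pi / real K
    \<and> sqrt (real d - 1) * sin (real (Suc K) * \<theta>) = - sin (real K * \<theta>)"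
proof -
  let ?p = "(real d - 1) powr (- (1 / 2))"
  have p: "?p = 1 / sqrt (real d - 1)" using d by (simp add: powr_minus_divide powr_half_sqrt)
  have p01: "0 < ?p" "?p \<le> 1" unfolding p using d by auto
  let ?G = "\<lambda>t. sin (t * real K) * cos t + cos (t * real K) * sin t + ?p * sin (t * real K)"
  have "\<exists>\<theta>. smallest_positive_root (\<lambda>t. tan (t * real K) = - (sin t / (?p + cos t))) \<theta>
    \<and> \<theta> < pi / real K \<and> ?G \<theta> = 0"
  proof (rule smallest_positive_root_exists[of ?G "pi / (2 * real K)"
        "if K = 1 then pi - pi / 3 else pi / real K" "pi / real K"])
    show "continuous_on UNIV ?G" by (intro continuous_intros)
    show "0 < ?G t" if "0 < t" "t < pi / (2 * real K)" for t
      using smaller_angle[OF K that] that K p01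
      by (intro add_pos_pos mult_pos_pos sin_gt_zero cos_gt_zero) auto
    show "tan (t * real K) = - (sin t / (?p + cos t)) \<longleftrightarrow> ?G t = 0"
      if "0 < t" "t < pi / real K" for t
      unfolding tan_def using small_angle[OF K that] that
      by (intro odd_girth_equation_iff) (auto intro: sin_gt_zero)
    have "sin (pi - pi / 3) = sin (pi / 3)" "cos (pi - pi / 3) = - (1 / 2)"
      by (simp_all only: sin_pi_minus cos_pi_minus cos_60)
    then have K1: "?G (pi - pi / 3) = sin (pi / 3) * (?p - 1)" if "K = 1"
      unfolding that of_nat_1 mult_1_right by (simp only:) (simp add: algebra_simps)
    have "sin (pi / 3) * (?p - 1) \<le> 0"
      using p01 by (intro mult_nonneg_nonpos) (auto simp: sin_60)
    moreover have "0 < sin (pi / real K)" if "K \<noteq> 1"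
      using that K by (intro sin_gt_zero) (auto simp: field_simps)
    ultimately show "?G (if K = 1 then pi - pi / 3 else pi / real K) \<le> 0"
      "?G (if K = 1 then pi - pi / 3 else pi / real K) < 0
        \<or> (if K = 1 then pi - pi / 3 else pi / real K) < pi / real K"
      using K K1 by (cases "K = 1"; simp)+
  qed (use K in \<open>auto simp: field_simps\<close>)
  moreover have "sqrt (real d - 1) * sin (real (Suc K) * \<theta>) = - sin (real K * \<theta>)" if "?G \<theta> = 0" for \<theta>
  proof -
    have "sin (real (Suc K) * \<theta>) = - (?p * sin (real K * \<theta>))"
      using that by (simp add: distrib_right sin_add algebra_simps)
    then show ?thesis using d by (simp add: p)
  qed
  ultimately show ?thesis by blast
qed

section \<open>The bounds for diameter and girth\<close>

text \<open>With \<open>q = s\<^sup>2\<close> and \<open>\<mu> = 2 * s * c\<close>, the scaling \<open>f r = k r / s ^ r\<close> turns the tree recursion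
\<open>\<mu> * f r = f (r - 1) + q * f (r + 1)\<close> into that of the sinusoids.\<close>

lemma tree_recurrence:
  fixes s :: real
  assumes "0 < s" "0 < r" "k (r - 1) + k (Suc r) = 2 * c * k r"
  shows "2 * s * c * (k r / s ^ r) = k (r - 1) / s ^ (r - 1) + s\<^sup>2 * (k (Suc r) / s ^ Suc r)"
proof -
  obtain j where j: "r = Suc j" using assms by (cases r) auto
  have "2 * s * c * (k r / s ^ r) = s * (k (r - 1) + k (Suc r)) / s ^ r"
    using assms(3) by simp
  also have "\<dots> = k (r - 1) / s ^ (r - 1) + s\<^sup>2 * (k (Suc r) / s ^ Suc r)"
    using assms(1) by (simp add: j field_simps power2_eq_square)
  finally show ?thesis .
qed

lemma sin_recurrence: "sin ((x + 1) * t) + sin ((x - 1) * t) = 2 * cos t * sin (x * t)" for t :: real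
  by (simp add: distrib_right left_diff_distrib sin_add sin_diff)

lemma two_sqrt_cos_le:
  assumes "2 \<le> d"
  shows "2 * sqrt (real d - 1) * cos t \<le> real d"
proof -
  let ?s = "sqrt (real d - 1)"
  have "2 * ?s * cos t \<le> 2 * ?s * 1" using assms by (intro mult_left_mono) auto
  also have "\<dots> \<le> ?s\<^sup>2 + 1" using sum_squares_bound[of ?s 1] by simp
  finally show ?thesis using assms by simp
qed

context finite_connected_graph
begin

text \<open>The profile is the sinusoid that vanishes at \<open>K\<close>. The equation for \<open>\<theta>\<close> is exactly the condition at the
centre of the ball, and \<open>\<theta> < pi / K\<close> makes the profile positive before \<open>K\<close>.\<close>

lemma even_diameter_bound:
  assumes reg: "regular_graph E d" and d: "2 \<le> d" and K: "0 < K" "dst u v = 2 * K"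
    and \<theta>: "0 < \<theta>" "\<theta> < pi / real K"
      "real d * sin \<theta> * cos (\<theta> * real K) + (real d - 2) * cos \<theta> * sin (\<theta> * real K) = 0"
  shows "algebraic_connectivity E \<le> real d - 2 * sqrt (real d - 1) * cos \<theta>"
proof -
  define s where "s = sqrt (real d - 1)"
  have s: "0 < s" "s\<^sup>2 = real d - 1" using d by (auto simp: s_def)
  define k where "k r = sin ((real K - real r) * \<theta>)" for r
  note a = small_angle[OF K(1) \<theta>(1,2)]
  show ?thesis
  proof (rule algebraic_connectivity_le_diameter[OF reg K(1), where u = u and v = v and f = "\<lambda>r. k r / s ^ r"])
    show "0 < k r / s ^ r" if "r < K" for r
    proof -
      have "(real K - real r) * \<theta> \<le> \<theta> * real K" using \<theta> by (simp add: algebra_simps)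
      then have "(real K - real r) * \<theta> < pi" using a by linarith
      with that \<theta> have "0 < k r" unfolding k_def by (intro sin_gt_zero) auto
      with s show ?thesis by simp
    qed
    show "2 * sqrt (real d - 1) * cos \<theta> * (k r / s ^ r)
        = k (r - 1) / s ^ (r - 1) + (real d - 1) * (k (Suc r) / s ^ Suc r)" if "0 < r" for r
    proof -
      have "k (r - 1) + k (Suc r) = 2 * cos \<theta> * k r"
        using sin_recurrence[of "real K - real r" \<theta>] that
        by (simp add: k_def of_nat_diff algebra_simps)
      from tree_recurrence[where k = k, OF s(1) that this] show ?thesis by (simp add: s(2) flip: s_def)
    qed
    have "(real K - real 1) * \<theta> = \<theta> * real K - \<theta>" by (simp add: algebra_simps)
    then have k01: "k 1 = sin (\<theta> * real K) * cos \<theta> - cos (\<theta> * real K) * sin \<theta>" "k 0 = sin (\<theta> * real K)"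
      by (simp_all only: k_def sin_diff) (simp add: mult.commute)
    have "2 * s\<^sup>2 * cos \<theta> * k 0 = real d * k 1"
      unfolding k01 s(2) using \<theta>(3) by (simp add: algebra_simps)
    then show "2 * sqrt (real d - 1) * cos \<theta> * (k 0 / s ^ 0) = real d * (k 1 / s ^ 1)"
      using s(1) by (simp add: field_simps power2_eq_square flip: s_def)
  qed (use K d two_sqrt_cos_le in \<open>auto simp: k_def\<close>)
qed

text \<open>The sinusoid \<open>h r + s * h (r + 1)\<close>, where \<open>h\<close> vanishes at \<open>K\<close>, is chosen so that the profile satisfies
\<open>f K = - f (K - 1)\<close>: crossing the middle edge of a shortest path between the centres changes its sign.
Again the equation for \<open>\<theta>\<close> is the condition at the centre; it says \<open>h 1 = s * h 0\<close>.\<close>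

lemma odd_diameter_bound:
  assumes reg: "regular_graph E d" and d: "2 \<le> d" and K: "2 \<le> K" "dst u v = 2 * K - 1"
    and \<theta>: "0 < \<theta>" "\<theta> < pi / real K"
      "sqrt (real d - 1) * sin (\<theta> * real K) = sin (\<theta> * real K) * cos \<theta> - cos (\<theta> * real K) * sin \<theta>"
  shows "algebraic_connectivity E \<le> real d - 2 * sqrt (real d - 1) * cos \<theta>"
proof -
  define s where "s = sqrt (real d - 1)"
  have s: "0 < s" "s\<^sup>2 = real d - 1" using d by (auto simp: s_def)
  define h where "h r = sin ((real K - real r) * \<theta>)" for r
  define k where "k r = h r + s * h (Suc r)" for r
  have K0: "0 < K" using K by simp
  note a = small_angle[OF K0 \<theta>(1,2)]
  have h_pos: "0 < h r" if "r < K" for r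
  proof -
    have "(real K - real r) * \<theta> \<le> \<theta> * real K" using \<theta> by (simp add: algebra_simps)
    then have "(real K - real r) * \<theta> < pi" using a by linarith
    with that \<theta> show "0 < h r" unfolding h_def by (intro sin_gt_zero) auto
  qed
  have h_rec: "h (r - 1) + h (Suc r) = 2 * cos \<theta> * h r" if "0 < r" for r
    using sin_recurrence[of "real K - real r" \<theta>] that
    by (simp add: h_def of_nat_diff algebra_simps)
  have hK: "h K = 0" "h (Suc K) = - sin \<theta>" "h (K - 1) = sin \<theta>"
    using K by (auto simp: h_def of_nat_diff)
  show ?thesis
  proof (rule algebraic_connectivity_le_diameter[OF reg K0, where u = u and v = v and f = "\<lambda>r. k r / s ^ r"])
    show "0 < k r / s ^ r" if "r < K" for r
      using that h_pos[of r] h_pos[of "Suc r"] hK s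
      by (cases "Suc r = K") (auto simp: k_def intro!: divide_pos_pos add_pos_pos mult_pos_pos)
    show "2 * sqrt (real d - 1) * cos \<theta> * (k r / s ^ r)
        = k (r - 1) / s ^ (r - 1) + (real d - 1) * (k (Suc r) / s ^ Suc r)" if "0 < r" for r
    proof -
      have "k (r - 1) + k (Suc r) = 2 * cos \<theta> * k r"
        using h_rec[OF that] arg_cong[OF h_rec[of "Suc r"], of "\<lambda>x. s * x"] that
        by (simp add: k_def algebra_simps)
      from tree_recurrence[where k = k, OF s(1) that this] show ?thesis by (simp add: s(2) flip: s_def)
    qed
    have "(real K - real 1) * \<theta> = \<theta> * real K - \<theta>" by (simp add: algebra_simps)
    then have h0: "h 1 = s * h 0"
      using \<theta>(3) by (simp only: h_def s_def sin_diff) (simp add: mult.commute)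
    have h2: "h (Suc 1) = 2 * cos \<theta> * (s * h 0) - h 0" using h_rec[of 1] h0 by simp
    have "2 * s\<^sup>2 * cos \<theta> * k 0 = (s\<^sup>2 + 1) * k 1"
      unfolding k_def h2 h0 One_nat_def[symmetric] by (simp add: power2_eq_square algebra_simps)
    then have "2 * s\<^sup>2 * cos \<theta> * k 0 = real d * k 1" by (simp add: s(2))
    then show "2 * sqrt (real d - 1) * cos \<theta> * (k 0 / s ^ 0) = real d * (k 1 / s ^ 1)"
      using s(1) by (simp add: field_simps power2_eq_square flip: s_def)
    obtain j where j: "K = Suc j" using K0 by (cases K) auto
    have "k K / s ^ K = - (k (K - 1) / s ^ (K - 1))"
      using hK s by (simp add: k_def j)
    then show "k K / s ^ K \<le> - (k (K - 1) / s ^ (K - 1))" by simp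
    have "0 < sin \<theta>" using a \<theta> by (intro sin_gt_zero) auto
    then show "k K / s ^ K \<le> 0" using hK s by (simp add: k_def divide_nonpos_pos)
  qed (use K d two_sqrt_cos_le in auto)
qed

text \<open>The profile is the sinusoid that vanishes at \<open>u\<close>. For girth \<open>2 * L + 2\<close> it vanishes again at \<open>L + 1\<close>; for
girth \<open>2 * L + 1\<close> the angle is chosen so that \<open>(d - 1) * f (L + 1) = - f L\<close>, which pays for the edge
to the other branch.\<close>

lemma girth_bound:
  assumes reg: "regular_graph E d" and d: "2 \<le> d" and g: "has_girth E g" "0 < L" "2 * L < g"
    and \<theta>: "0 < \<theta>" "real L * \<theta> < pi"
    and leaf: "sqrt (real d - 1) * sin (real (Suc L) * \<theta>) \<le> - (if 2 * L + 1 < g then 0 else sin (real L * \<theta>))"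
  shows "algebraic_connectivity E \<le> real d - 2 * sqrt (real d - 1) * cos \<theta>"
proof -
  define s where "s = sqrt (real d - 1)"
  have s: "0 < s" "s\<^sup>2 = real d - 1" using d by (auto simp: s_def)
  define k where "k r = sin (real r * \<theta>)" for r
  have rec: "2 * sqrt (real d - 1) * cos \<theta> * (k r / s ^ r)
        = k (r - 1) / s ^ (r - 1) + (real d - 1) * (k (Suc r) / s ^ Suc r)" if "0 < r" for r
  proof -
    have "k (r - 1) + k (Suc r) = 2 * cos \<theta> * k r"
      using sin_recurrence[of "real r" \<theta>] that
      by (simp add: k_def of_nat_diff algebra_simps)
    from tree_recurrence[where k = k, OF s(1) that this] show ?thesis by (simp add: s(2) flip: s_def)
  qed
  show ?thesis
  proof (rule algebraic_connectivity_le_girth[OF reg g, where f = "\<lambda>r. k r / s ^ r"])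
    show "0 < k r / s ^ r" if "0 < r" "r \<le> L" for r
    proof -
      have "real r * \<theta> \<le> real L * \<theta>" using \<theta> that by (intro mult_right_mono) auto
      then have "real r * \<theta> < pi" using \<theta> by linarith
      with that \<theta> have "0 < k r" unfolding k_def by (intro sin_gt_zero) auto
      with s show ?thesis by simp
    qed
    have "s * k (Suc L) / s ^ L \<le> - (if 2 * L + 1 < g then 0 else k L) / s ^ L"
      using leaf s unfolding k_def s_def by (intro divide_right_mono) auto
    moreover have "(real d - 1) * (k (Suc L) / s ^ Suc L) = s * k (Suc L) / s ^ L"
      using s(1) by (simp add: field_simps power2_eq_square flip: s(2))
    ultimately show "2 * sqrt (real d - 1) * cos \<theta> * (k L / s ^ L)
      \<le> k (L - 1) / s ^ (L - 1) - (if 2 * L + 1 < g then 0 else k L / s ^ L)"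
      using rec[OF g(2)] by (auto split: if_splits)
  qed (use rec in \<open>auto simp: k_def\<close>)
qed

end

theorem theoremI2:
  fixes E :: "'v::finite \<Rightarrow> 'v \<Rightarrow> bool" and d g D :: nat
  assumes "simple_graph E"
    and "regular_graph E d"
    and "has_girth E g"
    and "has_diameter E D"
  shows
    "(\<forall>K::nat. K > 0 \<and> D = 2 * K \<longrightarrow>
       (\<exists>\<theta>. smallest_positive_root
              (\<lambda>t. tan (t * real K) = - (real d / (real d - 2)) * tan t) \<theta> \<and>
            algebraic_connectivity E \<le> real d - 2 * sqrt (real d - 1) * cos \<theta>)) \<and>
     (\<forall>K::nat. K > 0 \<and> D = 2 * K - 1 \<longrightarrow>
       (\<exists>\<theta>. smallest_positive_root
              (\<lambda>t. tan (t * real K) =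
                 - (((2 * sqrt (real d - 1) * cos t + real d) * sin t) /
                    (sqrt (real d - 1) * (real d - 2 * (cos t)\<^sup>2) + (real d - 2) * cos t))) \<theta> \<and>
            algebraic_connectivity E \<le> real d - 2 * sqrt (real d - 1) * cos \<theta>)) \<and>
     (\<forall>K::nat. K > 0 \<and> g = 2 * K \<longrightarrow>
        algebraic_connectivity E \<le> real d - 2 * sqrt (real d - 1) * cos (pi / real K)) \<and>
     (\<forall>K::nat. K > 0 \<and> g = 2 * K + 1 \<longrightarrow>
       (\<exists>\<theta>. smallest_positive_root
              (\<lambda>t. tan (t * real K) =
                 - (sin t / ((real d - 1) powr (- (1 / 2)) + cos t))) \<theta> \<and>
            algebraic_connectivity E \<le> real d - 2 * sqrt (real d - 1) * cos \<theta>))"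
proof -
  interpret finite_connected_graph E
    using assms by unfold_locales (auto simp: has_diameter_def)
  have d: "2 \<le> d" by (rule degree_ge_2) fact+
  obtain u v where uv: "dst u v = D" using diameter_attained[OF assms(4)] .
  show ?thesis
  proof (intro conjI allI impI; elim conjE)
    fix K :: nat assume K: "K > 0" "D = 2 * K"
    obtain \<theta> where \<theta>:
      "smallest_positive_root (\<lambda>t. tan (t * real K) = - (real d / (real d - 2)) * tan t) \<theta>"
      "\<theta> < pi / real K"
      "real d * sin \<theta> * cos (\<theta> * real K) + (real d - 2) * cos \<theta> * sin (\<theta> * real K) = 0"
      using even_diameter_root[OF d K(1)] by blast
    moreover have "0 < \<theta>" using \<theta>(1) by (simp add: smallest_positive_root_def)
    ultimately show "\<exists>\<theta>. smallest_positive_root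
              (\<lambda>t. tan (t * real K) = - (real d / (real d - 2)) * tan t) \<theta> \<and>
            algebraic_connectivity E \<le> real d - 2 * sqrt (real d - 1) * cos \<theta>"
      using even_diameter_bound[OF assms(2) d K(1), of u v \<theta>] uv K by blast
  next
    fix K :: nat assume K: "K > 0" "D = 2 * K - 1"
    let ?eqn = "\<lambda>K t. tan (t * real K) =
                 - (((2 * sqrt (real d - 1) * cos t + real d) * sin t) /
                    (sqrt (real d - 1) * (real d - 2 * (cos t)\<^sup>2) + (real d - 2) * cos t))"
    show "\<exists>\<theta>. smallest_positive_root (?eqn K) \<theta> \<and>
            algebraic_connectivity E \<le> real d - 2 * sqrt (real d - 1) * cos \<theta>"
    proof (cases "K = 1")
      case True
      then have "u \<noteq> v" using uv K by auto
      have "1 \<le> sqrt (real d - 1)" using d by simp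
      \<comment> \<open>here \<open>\<theta> = pi\<close>, and the indicator functions give the stronger bound \<open>d + 1\<close>\<close>
      then have "algebraic_connectivity E \<le> real d - 2 * sqrt (real d - 1) * cos pi"
        using algebraic_connectivity_le_degree_plus_1[OF assms(2) \<open>u \<noteq> v\<close>]
        unfolding cos_pi by linarith
      then show ?thesis using odd_diameter_one_root[OF d] True by blast
    next
      case False
      then have K2: "2 \<le> K" using K by simp
      obtain \<theta> where \<theta>:
        "smallest_positive_root (?eqn K) \<theta>" "\<theta> < pi / real K"
        "sqrt (real d - 1) * sin (\<theta> * real K) = sin (\<theta> * real K) * cos \<theta> - cos (\<theta> * real K) * sin \<theta>"
        using odd_diameter_root[OF d K2] by auto
      moreover have "0 < \<theta>" using \<theta>(1) by (simp add: smallest_positive_root_def)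
      ultimately show ?thesis
        using odd_diameter_bound[OF assms(2) d K2, of u v \<theta>] uv K by blast
    qed
  next
    fix K :: nat assume K: "K > 0" "g = 2 * K"
    have "3 \<le> g" using assms(3) by (auto simp: has_girth_def is_cycle_def)
    then have L: "0 < K - 1" "2 * (K - 1) < g" "2 * (K - 1) + 1 < g" "Suc (K - 1) = K" using K by auto
    have "real (K - 1) * (pi / real K) < pi" using K by (simp add: field_simps of_nat_diff)
    then show "algebraic_connectivity E \<le> real d - 2 * sqrt (real d - 1) * cos (pi / real K)"
      using K L by (intro girth_bound[OF assms(2) d assms(3) L(1,2)]) auto
  next
    fix K :: nat assume K: "K > 0" "g = 2 * K + 1"
    obtain \<theta> where \<theta>:
      "smallest_positive_root
         (\<lambda>t. tan (t * real K) = - (sin t / ((real d - 1) powr (- (1 / 2)) + cos t))) \<theta>"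
      "\<theta> < pi / real K"
      "sqrt (real d - 1) * sin (real (Suc K) * \<theta>) = - sin (real K * \<theta>)"
      using odd_girth_root[OF d K(1)] by blast
    have "0 < \<theta>" using \<theta>(1) by (simp add: smallest_positive_root_def)
    then have "algebraic_connectivity E \<le> real d - 2 * sqrt (real d - 1) * cos \<theta>"
      using K \<open>0 < \<theta>\<close> \<theta>(2,3)
      by (intro girth_bound[OF assms(2) d assms(3) K(1)]) (auto simp: pos_less_divide_eq mult.commute)
    with \<theta>(1) show "\<exists>\<theta>. smallest_positive_root
              (\<lambda>t. tan (t * real K) = - (sin t / ((real d - 1) powr (- (1 / 2)) + cos t))) \<theta> \<and>
            algebraic_connectivity E \<le> real d - 2 * sqrt (real d - 1) * cos \<theta>" by blast
  qed
qed

end
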